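(* Every finitely generated large group $\Gamma$ has infinite girth, i.e. $\operatorname{Gir}(\Gamma)=\infty$.
   Context: A group is large if it has a finite-index subgroup which surjects onto a nonabelian free group. Girth: for a finitely generated group $\Gamma$ and a finite generating set $S$, consider words in the formal alphabet $S^{\pm1}$. A word is reduced if no letter is immediately followed by its formal inverse, and cyclically reduced if, in addition, the first and last letters are not formal inverses. $\operatorname{Gir}(\Gamma,S)$ is the smallest length of a nonempty cyclically reduced word representing the identity of $\Gamma$, with $\operatorname{Gir}(\Gamma,S)=\infty$ if no such word exists; $\operatorname{Gir}(\Gamma)=\sup_S\operatorname{Gir}(\Gamma,S)$ over all finite generating sets $S$. *)

theory Defs
  imports "HOL-Algebra.Coset" "HOL-Algebra.Generated_Groups" "HOL-Library.Extended_Nat"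
begin

section \<open>Words in a formal alphabet\<close>

text \<open>The letter \<open>(s, True)\<close> stands for \<open>s\<close> and \<open>(s, False)\<close> for its formal inverse. The alphabet
  is formal: even if \<open>s\<close> and \<open>t\<close> are elements of a group with \<open>t\<close> inverse to \<open>s\<close>, the letters
  \<open>(t, True)\<close> and \<open>(s, False)\<close> are distinct.\<close>

type_synonym 'a letter = "'a \<times> bool"

definition formal_inv :: "'a letter \<Rightarrow> 'a letter" where
  "formal_inv l = (fst l, \<not> snd l)"

definition words :: "'a set \<Rightarrow> 'a letter list set" where
  "words S = lists (S \<times> UNIV)"

definition reduced :: "'a letter list \<Rightarrow> bool" where
  "reduced w \<longleftrightarrow> successively (\<lambda>l m. m \<noteq> formal_inv l) w"

definition cyclically_reduced :: "'a letter list \<Rightarrow> bool" where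
  "cyclically_reduced w \<longleftrightarrow> reduced w \<and> (w \<noteq> [] \<longrightarrow> last w \<noteq> formal_inv (hd w))"

definition letter_value :: "('a, 'b) monoid_scheme \<Rightarrow> 'a letter \<Rightarrow> 'a" where
  "letter_value G l = (if snd l then fst l else inv\<^bsub>G\<^esub> (fst l))"

definition word_value :: "('a, 'b) monoid_scheme \<Rightarrow> 'a letter list \<Rightarrow> 'a" where
  "word_value G w = foldr (\<lambda>l g. letter_value G l \<otimes>\<^bsub>G\<^esub> g) w \<one>\<^bsub>G\<^esub>"


section \<open>Girth\<close>

definition finite_generating_set :: "('a, 'b) monoid_scheme \<Rightarrow> 'a set \<Rightarrow> bool" where
  "finite_generating_set G S \<longleftrightarrow> finite S \<and> S \<subseteq> carrier G \<and> generate G S = carrier G"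

definition finitely_generated :: "('a, 'b) monoid_scheme \<Rightarrow> bool" where
  "finitely_generated G \<longleftrightarrow> (\<exists>S. finite_generating_set G S)"

text \<open>In \<open>enat\<close> the infimum of a nonempty set is its least element, the infimum of the empty set
  is \<open>\<infinity>\<close>, and the supremum of an unbounded set is \<open>\<infinity>\<close>.\<close>

definition girth_wrt :: "('a, 'b) monoid_scheme \<Rightarrow> 'a set \<Rightarrow> enat" where
  "girth_wrt G S =
     (INF w \<in> {w \<in> words S. w \<noteq> [] \<and> cyclically_reduced w \<and> word_value G w = \<one>\<^bsub>G\<^esub>}.
        enat (length w))"

definition girth :: "('a, 'b) monoid_scheme \<Rightarrow> enat" where
  "girth G = (SUP S \<in> {S. finite_generating_set G S}. girth_wrt G S)"


section \<open>Free groups and large groups\<close>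

text \<open>The free group on \<open>X\<close> consists of the reduced words over \<open>X\<close>; the product is
  concatenation followed by free reduction, computed letter by letter from the right.\<close>

fun cons_reduce :: "'a letter \<Rightarrow> 'a letter list \<Rightarrow> 'a letter list" where
  "cons_reduce l [] = [l]"
| "cons_reduce l (m # w) = (if m = formal_inv l then w else l # m # w)"

definition free_group :: "'a set \<Rightarrow> 'a letter list monoid" where
  "free_group X =
     \<lparr>carrier = {w \<in> words X. reduced w}, mult = (\<lambda>u v. foldr cons_reduce u v), one = []\<rparr>"

text \<open>The basis \<open>X\<close> may be taken in the type of \<open>G\<close>: lifting a basis of a free quotient
  of a subgroup \<open>H\<close> along the surjection embeds the basis in \<open>H\<close>. See \<open>largeI\<close> below.\<close>

definition large :: "('a, 'b) monoid_scheme \<Rightarrow> bool" where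
  "large G \<longleftrightarrow>
     (\<exists>H. subgroup H G \<and> finite (rcosets\<^bsub>G\<^esub> H) \<and>
        (\<exists>(X :: 'a set) f. f \<in> epi (G\<lparr>carrier := H\<rparr>) (free_group X) \<and> \<not> comm_group (free_group X)))"


subsection \<open>Basic properties\<close>

lemma formal_inv_simps [simp]:
  "formal_inv (formal_inv l) = l" "formal_inv l = formal_inv m \<longleftrightarrow> l = m"
  "formal_inv l \<noteq> l" "l \<noteq> formal_inv l" "fst (formal_inv l) = fst l"
  by (auto simp: formal_inv_def prod_eq_iff)

lemma reduced_simps [simp]:
  "reduced []" "reduced [l]"
  "reduced (l # m # w) \<longleftrightarrow> m \<noteq> formal_inv l \<and> reduced (m # w)"
  by (auto simp: reduced_def)

lemma reduced_tl: "reduced (l # w) \<Longrightarrow> reduced w"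
  by (cases w) auto

lemma reduced_cons_reduce: "reduced w \<Longrightarrow> reduced (cons_reduce l w)"
  by (cases w) (auto dest: reduced_tl)

lemma cons_reduce_formal_inv: "reduced w \<Longrightarrow> cons_reduce l (cons_reduce (formal_inv l) w) = w"
  by (cases w rule: remdups_adj.cases) auto

lemma cons_reduce_reduced: "reduced (l # w) \<Longrightarrow> cons_reduce l w = l # w"
  by (cases w) auto

lemma foldr_reduced: "reduced v \<Longrightarrow> reduced (foldr cons_reduce u v)"
  by (induction u) (auto intro: reduced_cons_reduce)

lemma words_simps [simp]: "[] \<in> words X" "l # w \<in> words X \<longleftrightarrow> fst l \<in> X \<and> w \<in> words X"
  by (auto simp: words_def) (metis UNIV_I mem_Sigma_iff prod.collapse)+

lemma cons_reduce_words: "fst l \<in> X \<Longrightarrow> w \<in> words X \<Longrightarrow> cons_reduce l w \<in> words X"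
  by (cases w) auto

lemma foldr_words: "u \<in> words X \<Longrightarrow> v \<in> words X \<Longrightarrow> foldr cons_reduce u v \<in> words X"
  by (induction u) (auto intro: cons_reduce_words)

lemma foldr_cons_reduce:
  assumes "reduced v"
  shows "foldr cons_reduce (cons_reduce l u) v = cons_reduce l (foldr cons_reduce u v)"
proof (cases u)
  case (Cons m w)
  then show ?thesis
    using cons_reduce_formal_inv[OF foldr_reduced[OF assms], of l w] by auto
qed auto

lemma foldr_assoc:
  assumes "reduced w"
  shows "foldr cons_reduce (foldr cons_reduce u v) w = foldr cons_reduce u (foldr cons_reduce v w)"
  by (induction u) (auto simp: foldr_cons_reduce[OF assms])

lemma foldr_Nil: "reduced u \<Longrightarrow> foldr cons_reduce u [] = u"
proof (induction u)
  case (Cons l u)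
  then show ?case by (simp add: cons_reduce_reduced reduced_tl[OF Cons.prems])
qed simp

lemma foldr_inverse:
  "reduced v \<Longrightarrow> foldr cons_reduce (rev (map formal_inv u)) (foldr cons_reduce u v) = v"
proof (induction u arbitrary: v)
  case (Cons l u)
  have "cons_reduce (formal_inv l) (cons_reduce l (foldr cons_reduce u v)) = foldr cons_reduce u v"
    using cons_reduce_formal_inv[OF foldr_reduced[OF Cons.prems], of "formal_inv l"] by simp
  then show ?case using Cons by simp
qed simp

lemma foldr_inverse_reduced:
  assumes "reduced u"
  shows "foldr cons_reduce (foldr cons_reduce (rev (map formal_inv u)) []) u = []"
  using foldr_inverse[of "[]" u] foldr_assoc[OF assms, of "rev (map formal_inv u)" "[]"]
    foldr_Nil[OF assms] by simp

lemma words_inverse: "u \<in> words X \<Longrightarrow> rev (map formal_inv u) \<in> words X"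
  by (auto simp: words_def lists_eq_set formal_inv_def)

lemma group_free_group: "group (free_group X)"
proof (rule groupI)
  fix u assume u: "u \<in> carrier (free_group X)"
  let ?v = "foldr cons_reduce (rev (map formal_inv u)) []"
  have "?v \<in> carrier (free_group X)" "?v \<otimes>\<^bsub>free_group X\<^esub> u = \<one>\<^bsub>free_group X\<^esub>"
    using u
    by (auto simp: free_group_def foldr_inverse_reduced
             intro!: foldr_reduced foldr_words words_inverse)
  then show "\<exists>v\<in>carrier (free_group X). v \<otimes>\<^bsub>free_group X\<^esub> u = \<one>\<^bsub>free_group X\<^esub>" by blast
qed (auto simp: free_group_def foldr_assoc intro: foldr_reduced foldr_words)


subsection \<open>The basis may live in any type\<close>

definition rename :: "('a \<Rightarrow> 'b) \<Rightarrow> 'a letter list \<Rightarrow> 'b letter list" where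
  "rename g = map (map_prod g id)"

lemma rename_simps [simp]:
  "rename g [] = []" "rename g (l # w) = (g (fst l), snd l) # rename g w"
  by (auto simp: rename_def map_prod_def split_beta)

lemma rename_words: "w \<in> words X \<Longrightarrow> rename g w \<in> words (g ` X)"
  by (induction w) auto

lemma rename_inverse: "inj_on g X \<Longrightarrow> w \<in> words X \<Longrightarrow> rename (inv_into X g) (rename g w) = w"
  by (induction w) auto

lemma rename_reduced: "inj_on g X \<Longrightarrow> w \<in> words X \<Longrightarrow> reduced (rename g w) \<longleftrightarrow> reduced w"
  by (induction w rule: induct_list012) (auto simp: formal_inv_def prod_eq_iff inj_on_eq_iff)

lemma rename_cons_reduce:
  "inj_on g X \<Longrightarrow> fst l \<in> X \<Longrightarrow> w \<in> words X \<Longrightarrow>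
     rename g (cons_reduce l w) = cons_reduce (g (fst l), snd l) (rename g w)"
  by (cases w) (auto simp: formal_inv_def prod_eq_iff dest: inj_onD)

lemma rename_foldr:
  "inj_on g X \<Longrightarrow> u \<in> words X \<Longrightarrow> v \<in> words X \<Longrightarrow>
     rename g (foldr cons_reduce u v) = foldr cons_reduce (rename g u) (rename g v)"
  by (induction u) (auto simp: rename_cons_reduce foldr_words)

lemma rename_iso:
  assumes g: "inj_on g X"
  shows "rename g \<in> iso (free_group X) (free_group (g ` X))"
proof -
  let ?h = "inv_into X g"
  have h: "inj_on ?h (g ` X)" "?h ` g ` X = X"
    using g by (auto intro: inj_on_inv_into)
  have gh: "rename g (rename ?h w) = w" if "w \<in> words (g ` X)" for w
    using that by (induction w) (auto simp: f_inv_into_f)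
  have "bij_betw (rename g) (carrier (free_group X)) (carrier (free_group (g ` X)))"
    using rename_words[of _ "g ` X" ?h] h(2) rename_reduced[OF h(1)]
    by (intro bij_betwI[of _ _ _ "rename ?h"])
       (auto simp: free_group_def gh rename_inverse[OF g] rename_reduced[OF g] intro: rename_words)
  then show ?thesis
    using g by (auto simp: iso_def hom_def free_group_def rename_foldr foldr_words foldr_reduced
                       rename_reduced intro: rename_words)
qed

lemma largeI:
  fixes G :: "('a, 'c) monoid_scheme" and Y :: "'y set"
  assumes "group G" and H: "subgroup H G" "finite (rcosets\<^bsub>G\<^esub> H)"
    and f: "f \<in> epi (G\<lparr>carrier := H\<rparr>) (free_group Y)" and nc: "\<not> comm_group (free_group Y)"
  shows "large G"
proof -
  have "\<exists>h\<in>H. f h = [(y, True)]" if "y \<in> Y" for y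
  proof -
    have "[(y, True)] \<in> carrier (free_group Y)" using that by (simp add: free_group_def)
    also have "\<dots> = f ` H" using f by (simp add: epi_def)
    finally show ?thesis by (auto simp: image_iff)
  qed
  then obtain g where "\<And>y. y \<in> Y \<Longrightarrow> f (g y) = [(y, True)]" by metis
  then have "inj_on g Y"
    by (intro inj_on_inverseI[of _ "\<lambda>h. fst (hd (f h))"]) simp
  then have iso: "rename g \<in> iso (free_group Y) (free_group (g ` Y))"
    by (rule rename_iso)
  have "rename g \<circ> f \<in> epi (G\<lparr>carrier := H\<rparr>) (free_group (g ` Y))"
  proof -
    have "f \<in> hom (G\<lparr>carrier := H\<rparr>) (free_group Y)" "f ` H = carrier (free_group Y)"
      using f by (auto simp: epi_def)
    moreover have "rename g \<in> hom (free_group Y) (free_group (g ` Y))"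
      "rename g ` carrier (free_group Y) = carrier (free_group (g ` Y))"
      using iso by (auto simp: iso_def bij_betw_def)
    ultimately show ?thesis
      by (simp add: epi_def hom_compose image_comp[symmetric] del: o_apply)
  qed
  moreover have "\<not> comm_group (free_group (g ` Y))"
  proof
    assume "comm_group (free_group (g ` Y))"
    moreover have "free_group (g ` Y) \<cong> free_group Y"
      by (rule group.iso_sym[OF group_free_group is_isoI[OF iso]])
    ultimately show False
      using nc comm_group.iso_imp_comm_group[OF _ _ group.is_monoid[OF group_free_group]] by metis
  qed
  ultimately show ?thesis
    unfolding large_def by (intro exI[of _ H] conjI H exI[of _ "g ` Y"] exI[of _ "rename g \<circ> f"])
qed

end

theory Submission
  imports Defs Complex_Main
begin

text \<open>
  Let \<open>H\<close> be a subgroup of finite index mapping onto a nonabelian free group, and let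
  \<open>s\<^sub>1, \<dots>, s\<^sub>k\<close> generate \<open>\<Gamma>\<close>. To defeat all relations of length at most \<open>n\<close>, pass to the generators
  \<open>a\<^sub>i\<close>, \<open>b\<^sub>i\<close> and \<open>a\<^sub>i\<^sup>M s\<^sub>i b\<^sub>i\<^sup>M\<close> with \<open>M > n\<close>, where the \<open>a\<^sub>i\<close> and \<open>b\<^sub>i\<close> are to be chosen.
  They still generate. Expand a reduced word of length at most \<open>n\<close> in them: since \<open>M\<close> exceeds the length,
  the long powers cancel only partially, and the result is a product
  \<open>x\<^sub>1\<^sup>E\<^sup>1 q\<^sub>1 x\<^sub>2\<^sup>E\<^sup>2 q\<^sub>2 \<dots>\<close> with nonzero exponents, every \<open>x\<^sub>j\<close> one of the \<open>a\<^sub>i\<close>, \<open>b\<^sub>i\<close>, every \<open>q\<^sub>j\<close> either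
  trivial or one of the \<open>s\<^sub>i\<close> or its inverse, and, decisively, with neighbours \<open>x\<^sub>j\<close> and \<open>x\<^sub>j\<^sub>+\<^sub>1\<close> always
  distinct generators: an \<open>s\<^sub>i\<close> separates a power of \<open>a\<^sub>i\<close> from a power of \<open>b\<^sub>i\<close>
  (\<open>syllables_alternating_aux\<close>).

  Let \<open>\<phi>\<close> be a homomorphism from \<open>H\<close> with nonabelian image in a group \<open>L\<close>, and choose the \<open>x\<^sub>j\<close> in the
  normal core of \<open>H\<close>. Collecting the prefixes \<open>p\<^sub>j\<close> of the expanded word on the right turns it into a
  product of the conjugates \<open>p\<^sub>j x\<^sub>j\<^sup>E\<^sup>j p\<^sub>j\<^sup>-\<^sup>1\<close> and one constant, so \<open>\<phi>\<close> sends it to a product of powers of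
  the elements \<open>\<phi>(p\<^sub>j x\<^sub>j p\<^sub>j\<^sup>-\<^sup>1)\<close>. Only finitely many prefixes \<open>p\<close> occur, and they are known in
  advance. Hence it suffices that \<open>\<phi>(p x p\<^sup>-\<^sup>1)\<close> and \<open>\<phi>(q y q\<^sup>-\<^sup>1)\<close> never commute for distinct generators
  \<open>x\<close>, \<open>y\<close> and prefixes \<open>p\<close>, \<open>q\<close>, and that \<open>L\<close> has the \<^emph>\<open>big powers\<close> property: if
  \<open>k\<^sub>1, \<dots>, k\<^sub>r\<close> with \<open>r \<ge> 1\<close> are nontrivial and consecutive ones do not commute, then \<open>k\<^sub>1\<^sup>m \<dots> k\<^sub>r\<^sup>m c\<close> is nontrivial for all large \<open>m\<close>. The first
  requirement excludes, for each new generator, finitely many subgroups of the core, and these are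
  closed under roots; a group is never a finite union of proper subgroups of that kind
  (\<open>avoid_isolated_subgroups\<close>). Replacing all generators by their \<open>m\<close>-th powers for a large \<open>m\<close> then
  makes every short word nontrivial (\<open>ex_independent_family\<close>).

  The target \<open>L\<close> need not be free. A free group on at least two letters has a homomorphism with
  nonabelian image to any nonabelian group, so \<open>L\<close> may be a congruence subgroup of the norm one units in an order of a rational
  quaternion division algebra that splits over the reals. There the big powers property is a limit
  computation with eigenvalues: after normalization the powers \<open>k\<^sup>m\<close> converge to rank one matrices, and
  two of these can multiply to zero only if the two units commute, because a nonzero element of
  the division algebra has nonzero norm (\<open>eigen_part_mult_nonzero\<close>, \<open>quat_big_powers\<close>).
\<close>

section \<open>Isolated subgroups and big powers\<close>

lemma (in group) subgroup_nat_pow: "subgroup K G \<Longrightarrow> x \<in> K \<Longrightarrow> x [^] (n::nat) \<in> K"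
  by (induction n) (simp_all add: subgroup.one_closed subgroup.m_closed)

definition isolated_subgroup :: "'a set \<Rightarrow> ('a, 'b) monoid_scheme \<Rightarrow> bool" where
  "isolated_subgroup C G \<longleftrightarrow>
     subgroup C G \<and> (\<forall>x\<in>carrier G. \<forall>k>0. x [^]\<^bsub>G\<^esub> (k::nat) \<in> C \<longrightarrow> x \<in> C)"

lemma isolated_subgroupI:
  "subgroup C G \<Longrightarrow> (\<And>x k. x \<in> carrier G \<Longrightarrow> k > 0 \<Longrightarrow> x [^]\<^bsub>G\<^esub> (k::nat) \<in> C \<Longrightarrow> x \<in> C) \<Longrightarrow>
    isolated_subgroup C G"
  by (simp add: isolated_subgroup_def)

lemma isolated_subgroupD:
  "isolated_subgroup C G \<Longrightarrow> subgroup C G"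
  "isolated_subgroup C G \<Longrightarrow> x \<in> carrier G \<Longrightarrow> k > 0 \<Longrightarrow> x [^]\<^bsub>G\<^esub> (k::nat) \<in> C \<Longrightarrow> x \<in> C"
  by (simp_all add: isolated_subgroup_def)

text \<open>Suppose \<open>x\<close> avoids all members of \<open>\<C>\<close> but lies in a further subgroup \<open>D\<close>, and \<open>y\<close> lies outside \<open>D\<close>.
  No \<open>x\<^sup>m y\<close> is in \<open>D\<close>. If \<open>x\<^sup>i y\<close> and \<open>x\<^sup>j y\<close> with \<open>i < j\<close> were in the same member of \<open>\<C>\<close>, then so would be
  \<open>x\<^sup>j\<^sup>-\<^sup>i\<close>, and hence \<open>x\<close> by isolation. So each of the finitely many members of \<open>\<C>\<close> contains at
  most one \<open>x\<^sup>m y\<close>.\<close>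
lemma (in group) avoid_isolated_subgroups:
  assumes "finite \<C>" "\<And>C. C \<in> \<C> \<Longrightarrow> isolated_subgroup C G \<and> C \<noteq> carrier G"
  shows "\<exists>x\<in>carrier G. \<forall>C\<in>\<C>. x \<notin> C"
  using assms
proof (induction \<C> rule: finite_induct)
  case (insert D \<C>)
  then obtain x where x: "x \<in> carrier G" "\<And>C. C \<in> \<C> \<Longrightarrow> x \<notin> C" by auto
  have D: "subgroup D G" "D \<noteq> carrier G" using insert.prems by (auto simp: isolated_subgroup_def)
  then obtain y where y: "y \<in> carrier G" "y \<notin> D" using subgroup.subset by blast
  show ?case
  proof (cases "x \<in> D")
    case False
    then show ?thesis using x by auto
  next
    case xD: True
    have "\<exists>m::nat. \<forall>C\<in>\<C>. x [^] m \<otimes> y \<notin> C"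
    proof (rule ccontr)
      assume "\<not> ?thesis"
      then obtain F where F: "\<And>m::nat. F m \<in> \<C> \<and> x [^] m \<otimes> y \<in> F m" by metis
      then have "\<not> inj F" using insert.hyps(1) finite_imageD[of F UNIV]
        by (metis finite_subset image_subsetI infinite_UNIV_nat)
      then obtain i j where ij: "i < j" "F i = F j" by (metis injI linorder_neqE_nat)
      have C: "isolated_subgroup (F i) G" "x \<notin> F i" using F insert.prems x by auto
      then interpret C: subgroup "F i" G by (simp add: isolated_subgroup_def)
      have "x [^] j \<otimes> y = x [^] (j - i) \<otimes> (x [^] i \<otimes> y)"
        using ij x(1) y(1) by (simp add: nat_pow_mult flip: m_assoc)
      then have "x [^] (j - i) = (x [^] j \<otimes> y) \<otimes> inv (x [^] i \<otimes> y)"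
        using inv_solve_right[of "x [^] (j - i)" "x [^] j \<otimes> y" "x [^] i \<otimes> y"] x(1) y(1) by simp
      moreover have "x [^] j \<otimes> y \<in> F i" "x [^] i \<otimes> y \<in> F i"
        using F[of j] F[of i] unfolding ij(2) by blast+
      ultimately have "x [^] (j - i) \<in> F i" by (simp only: C.m_closed C.m_inv_closed)
      then show False using C x(1) ij(1) by (auto simp: isolated_subgroup_def)
    qed
    then obtain m :: nat where m: "\<And>C. C \<in> \<C> \<Longrightarrow> x [^] m \<otimes> y \<notin> C" by blast
    interpret D: subgroup D G by fact
    have "x [^] m \<otimes> y \<notin> D"
    proof
      assume *: "x [^] m \<otimes> y \<in> D"
      have "x [^] m \<in> D" by (rule subgroup_nat_pow[OF D(1) xD])
      then have "inv (x [^] m) \<otimes> (x [^] m \<otimes> y) \<in> D" using * by blast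
      then show False using x(1) y by (simp flip: m_assoc)
    qed
    with m x(1) y(1) show ?thesis by (intro bexI[of _ "x [^] m \<otimes> y"]) auto
  qed
qed auto

lemma isolated_subgroup_int_pow:
  assumes "group G" "isolated_subgroup C G" "x \<in> carrier G" "x [^]\<^bsub>G\<^esub> (e::int) \<in> C" "e \<noteq> 0"
  shows "x \<in> C"
proof -
  interpret group G by fact
  interpret C: subgroup C G using assms(2) by (rule isolated_subgroupD)
  obtain n :: nat where n: "e = int n \<or> e = - int n" by (cases e rule: int_cases2) auto
  then have "n > 0" using assms(5) by auto
  moreover have "x [^]\<^bsub>G\<^esub> n \<in> C"
    using n
  proof
    assume "e = int n"
    then show ?thesis using assms(4) by (simp only: int_pow_int)
  next
    assume "e = - int n"
    then have "inv\<^bsub>G\<^esub> (x [^]\<^bsub>G\<^esub> n) \<in> C" using assms(3,4) by (simp only: int_pow_neg_int)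
    then have "inv\<^bsub>G\<^esub> (inv\<^bsub>G\<^esub> (x [^]\<^bsub>G\<^esub> n)) \<in> C" by (rule C.m_inv_closed)
    then show ?thesis using assms(3) by (simp only: inv_inv nat_pow_closed)
  qed
  ultimately show ?thesis by (rule isolated_subgroupD(2)[OF assms(2,3)])
qed

lemma isolated_subgroup_preimage:
  assumes "group G" "group L" "h \<in> hom G L" "isolated_subgroup C L"
  shows "isolated_subgroup {x \<in> carrier G. h x \<in> C} G"
proof -
  let ?K = "{x \<in> carrier G. h x \<in> C}"
  interpret group_hom G L h using assms by (simp add: group_hom_def group_hom_axioms_def)
  have C: "subgroup C L" using assms(4) by (rule isolated_subgroupD)
  show ?thesis
  proof (rule isolated_subgroupI)
    show "subgroup ?K G"
    proof (rule G.subgroupI)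
      have "\<one>\<^bsub>G\<^esub> \<in> ?K" by (simp add: subgroup.one_closed[OF C])
      then show "?K \<noteq> {}" by blast
    qed (simp_all add: subset_iff subgroup.m_closed[OF C] subgroup.m_inv_closed[OF C])
  next
    fix x and k :: nat
    assume x: "x \<in> carrier G" and k: "k > 0" "x [^]\<^bsub>G\<^esub> k \<in> ?K"
    have "h x [^]\<^bsub>L\<^esub> k \<in> C" using k hom_nat_pow[OF x, of k] by simp
    then show "x \<in> ?K" using isolated_subgroupD(2)[OF assms(4) hom_closed[OF x] k(1)] x by simp
  qed
qed

text \<open>Free groups have the following two properties, and so does the quaternion group below. They are all
  that the construction of generating sets of large girth uses about the target group.\<close>
definition commutation_transitive :: "('a, 'b) monoid_scheme \<Rightarrow> bool" where
  "commutation_transitive L \<longleftrightarrow> (\<forall>x\<in>carrier L. \<forall>y\<in>carrier L. \<forall>z\<in>carrier L.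
     y \<noteq> \<one>\<^bsub>L\<^esub> \<longrightarrow> x \<otimes>\<^bsub>L\<^esub> y = y \<otimes>\<^bsub>L\<^esub> x \<longrightarrow> y \<otimes>\<^bsub>L\<^esub> z = z \<otimes>\<^bsub>L\<^esub> y \<longrightarrow>
     x \<otimes>\<^bsub>L\<^esub> z = z \<otimes>\<^bsub>L\<^esub> x)"

definition big_powers :: "('a, 'b) monoid_scheme \<Rightarrow> bool" where
  "big_powers L \<longleftrightarrow> (\<forall>ks c. ks \<noteq> [] \<longrightarrow> set ks \<subseteq> carrier L - {\<one>\<^bsub>L\<^esub>} \<longrightarrow> c \<in> carrier L \<longrightarrow>
     successively (\<lambda>k l. k \<otimes>\<^bsub>L\<^esub> l \<noteq> l \<otimes>\<^bsub>L\<^esub> k) ks \<longrightarrow>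
     eventually (\<lambda>n::nat. foldr (\<lambda>k g. k [^]\<^bsub>L\<^esub> n \<otimes>\<^bsub>L\<^esub> g) ks c \<noteq> \<one>\<^bsub>L\<^esub>) sequentially)"

text \<open>A nontrivial element of finite order would give a one-term product that is trivial for
  arbitrarily large exponents.\<close>
lemma big_powers_torsion_free:
  assumes "group L" "big_powers L"
  shows "isolated_subgroup {\<one>\<^bsub>L\<^esub>} L"
proof -
  interpret group L by fact
  have "x = \<one>\<^bsub>L\<^esub>" if x: "x \<in> carrier L" "x [^]\<^bsub>L\<^esub> k = \<one>\<^bsub>L\<^esub>" "k > 0" for x and k :: nat
  proof (rule ccontr)
    assume "x \<noteq> \<one>\<^bsub>L\<^esub>"
    then have "eventually (\<lambda>n::nat. foldr (\<lambda>k g. k [^]\<^bsub>L\<^esub> n \<otimes>\<^bsub>L\<^esub> g) [x] \<one>\<^bsub>L\<^esub> \<noteq> \<one>\<^bsub>L\<^esub>) sequentially"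
      using assms(2) x(1) unfolding big_powers_def by (elim allE[of _ "[x]"] allE[of _ "\<one>\<^bsub>L\<^esub>"]) auto
    then obtain m :: nat where m: "\<And>n. n \<ge> m \<Longrightarrow> x [^]\<^bsub>L\<^esub> n \<noteq> \<one>\<^bsub>L\<^esub>"
      using x(1) by (auto simp: eventually_sequentially)
    have "x [^]\<^bsub>L\<^esub> (k * m) = \<one>\<^bsub>L\<^esub>" 
      using nat_pow_pow[OF x(1), of k m] x(2) by simp
    moreover have "k * m \<ge> m" using x(3) by simp
    ultimately show False using m by blast
  qed
  then show ?thesis by (auto simp: isolated_subgroup_def triv_subgroup)
qed

text \<open>If \<open>x\<^sup>k\<close> commutes with \<open>u\<close> and \<open>x \<noteq> \<one>\<close>, then \<open>x\<^sup>k\<close> is nontrivial by torsion-freeness and commutes both with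
  \<open>x\<close> and with \<open>u\<close>, so commutation passes from \<open>x\<close> to \<open>u\<close>.\<close>
lemma isolated_centralizer:
  assumes "group L" "big_powers L" "commutation_transitive L" and u: "u \<in> carrier L"
  shows "isolated_subgroup {x \<in> carrier L. x \<otimes>\<^bsub>L\<^esub> u = u \<otimes>\<^bsub>L\<^esub> x} L"
proof -
  interpret group L by fact
  let ?C = "{x \<in> carrier L. x \<otimes>\<^bsub>L\<^esub> u = u \<otimes>\<^bsub>L\<^esub> x}"
  have "subgroup ?C L"
  proof (rule subgroupI)
    fix x assume "x \<in> ?C"
    then have x: "x \<in> carrier L" "x \<otimes>\<^bsub>L\<^esub> u = u \<otimes>\<^bsub>L\<^esub> x" by auto
    have "inv\<^bsub>L\<^esub> x \<otimes>\<^bsub>L\<^esub> u = inv\<^bsub>L\<^esub> x \<otimes>\<^bsub>L\<^esub> (u \<otimes>\<^bsub>L\<^esub> x) \<otimes>\<^bsub>L\<^esub> inv\<^bsub>L\<^esub> x"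
      using x(1) u by (simp add: m_assoc)
    also have "\<dots> = u \<otimes>\<^bsub>L\<^esub> inv\<^bsub>L\<^esub> x" unfolding x(2)[symmetric] using x(1) u by (simp flip: m_assoc)
    finally show "inv\<^bsub>L\<^esub> x \<in> ?C" using x(1) by simp
  next
    fix x y assume xy: "x \<in> ?C" "y \<in> ?C"
    then have x: "x \<in> carrier L" and y: "y \<in> carrier L" by auto
    have "x \<otimes>\<^bsub>L\<^esub> y \<otimes>\<^bsub>L\<^esub> u = x \<otimes>\<^bsub>L\<^esub> (y \<otimes>\<^bsub>L\<^esub> u)" using x y u by (simp add: m_assoc)
    also have "y \<otimes>\<^bsub>L\<^esub> u = u \<otimes>\<^bsub>L\<^esub> y" using xy by blast
    also have "x \<otimes>\<^bsub>L\<^esub> (u \<otimes>\<^bsub>L\<^esub> y) = x \<otimes>\<^bsub>L\<^esub> u \<otimes>\<^bsub>L\<^esub> y" using x y u by (simp add: m_assoc)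
    also have "x \<otimes>\<^bsub>L\<^esub> u = u \<otimes>\<^bsub>L\<^esub> x" using xy by blast
    also have "u \<otimes>\<^bsub>L\<^esub> x \<otimes>\<^bsub>L\<^esub> y = u \<otimes>\<^bsub>L\<^esub> (x \<otimes>\<^bsub>L\<^esub> y)" using x y u by (simp add: m_assoc)
    finally show "x \<otimes>\<^bsub>L\<^esub> y \<in> ?C" using xy by simp
  qed (use u in \<open>auto intro: exI[of _ "\<one>\<^bsub>L\<^esub>"]\<close>)
  moreover have "x \<in> ?C" if x: "x \<in> carrier L" "k > 0" "x [^]\<^bsub>L\<^esub> k \<in> ?C" for x and k :: nat
  proof (cases "x = \<one>\<^bsub>L\<^esub>")
    case False
    then have "x [^]\<^bsub>L\<^esub> k \<noteq> \<one>\<^bsub>L\<^esub>"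
      using big_powers_torsion_free[OF assms(1,2)] x by (auto simp: isolated_subgroup_def)
    moreover have "x \<otimes>\<^bsub>L\<^esub> x [^]\<^bsub>L\<^esub> k = x [^]\<^bsub>L\<^esub> k \<otimes>\<^bsub>L\<^esub> x"
      using x(1) by (metis nat_pow_Suc nat_pow_Suc2)
    ultimately show ?thesis
      using assms(3) x u unfolding commutation_transitive_def by blast
  qed (use u in simp)
  ultimately show ?thesis by (auto simp: isolated_subgroup_def)
qed

lemma not_commute_int_pow:
  fixes d e :: int
  assumes "group L" "big_powers L" "commutation_transitive L" "u \<in> carrier L" "v \<in> carrier L"
    "u \<otimes>\<^bsub>L\<^esub> v \<noteq> v \<otimes>\<^bsub>L\<^esub> u" "d \<noteq> 0" "e \<noteq> 0"
  shows "u [^]\<^bsub>L\<^esub> d \<otimes>\<^bsub>L\<^esub> v [^]\<^bsub>L\<^esub> e \<noteq> v [^]\<^bsub>L\<^esub> e \<otimes>\<^bsub>L\<^esub> u [^]\<^bsub>L\<^esub> d"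
proof
  interpret group L by fact
  assume *: "u [^]\<^bsub>L\<^esub> d \<otimes>\<^bsub>L\<^esub> v [^]\<^bsub>L\<^esub> e = v [^]\<^bsub>L\<^esub> e \<otimes>\<^bsub>L\<^esub> u [^]\<^bsub>L\<^esub> d"
  have "u [^]\<^bsub>L\<^esub> d \<in> {x \<in> carrier L. x \<otimes>\<^bsub>L\<^esub> v [^]\<^bsub>L\<^esub> e = v [^]\<^bsub>L\<^esub> e \<otimes>\<^bsub>L\<^esub> x}"
    using * int_pow_closed[OF assms(4)] by blast
  from isolated_subgroup_int_pow[OF assms(1) isolated_centralizer[OF assms(1-3) int_pow_closed[OF assms(5)]]
      assms(4) this assms(7)]
  have "v [^]\<^bsub>L\<^esub> e \<in> {x \<in> carrier L. x \<otimes>\<^bsub>L\<^esub> u = u \<otimes>\<^bsub>L\<^esub> x}"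
    using int_pow_closed[OF assms(5)] by simp
  from isolated_subgroup_int_pow[OF assms(1) isolated_centralizer[OF assms(1-4)] assms(5) this assms(8)]
  show False using assms(6) by simp
qed

section \<open>Conjugates seen through a homomorphism on a subgroup of finite index\<close>

text \<open>A homomorphism \<open>\<phi>\<close> defined on \<open>H\<close> only. On the normal core of \<open>H\<close> each element \<open>p\<close> of \<open>G\<close> gives a further
  homomorphism \<open>x \<mapsto> \<phi>(p x p\<^sup>-\<^sup>1)\<close>, called the coordinate at \<open>p\<close>.\<close>
locale virtual_hom = group G + L: group L
  for G :: "('a, 'b) monoid_scheme" (structure) and L :: "('c, 'd) monoid_scheme" +
  fixes H :: "'a set" and \<phi> :: "'a \<Rightarrow> 'c"
  assumes H: "subgroup H G" "finite (rcosets H)"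
    and phi: "\<phi> \<in> hom (G\<lparr>carrier := H\<rparr>) L"
    and phi_nonabelian: "\<exists>a\<in>H. \<exists>b\<in>H. \<phi> a \<otimes>\<^bsub>L\<^esub> \<phi> b \<noteq> \<phi> b \<otimes>\<^bsub>L\<^esub> \<phi> a"
    and L: "commutation_transitive L" "big_powers L"
begin

sublocale H: subgroup H G by (rule H)

definition core :: "'a set" where
  "core = {x \<in> carrier G. \<forall>p\<in>carrier G. p \<otimes> x \<otimes> inv p \<in> H}"

definition coord :: "'a \<Rightarrow> 'a \<Rightarrow> 'c" where
  "coord p x = \<phi> (p \<otimes> x \<otimes> inv p)"

lemma coreI:
  "x \<in> carrier G \<Longrightarrow> (\<And>p. p \<in> carrier G \<Longrightarrow> p \<otimes> x \<otimes> inv p \<in> H) \<Longrightarrow> x \<in> core"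
  by (simp add: core_def)

lemma coreD: "x \<in> core \<Longrightarrow> p \<in> carrier G \<Longrightarrow> p \<otimes> x \<otimes> inv p \<in> H"
  by (simp add: core_def)

lemma inv_cancel:
  assumes "p \<in> carrier G" "x \<in> carrier G"
  shows "inv p \<otimes> (p \<otimes> x) = x" "p \<otimes> (inv p \<otimes> x) = x"
  using assms m_assoc[of "inv p" p x, symmetric] m_assoc[of p "inv p" x, symmetric] by simp_all

lemma conj_mult:
  assumes "p \<in> carrier G" "x \<in> carrier G" "y \<in> carrier G"
  shows "p \<otimes> (x \<otimes> y) \<otimes> inv p = (p \<otimes> x \<otimes> inv p) \<otimes> (p \<otimes> y \<otimes> inv p)"
  using assms by (simp add: m_assoc inv_cancel)

lemma conj_nat_pow:
  assumes "p \<in> carrier G" "x \<in> carrier G"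
  shows "p \<otimes> x [^] (k::nat) \<otimes> inv p = (p \<otimes> x \<otimes> inv p) [^] k"
  using assms by (induction k) (simp_all add: conj_mult)

lemma subgroup_core: "subgroup core G"
proof (rule subgroupI)
  show "core \<noteq> {}" by (auto simp: core_def intro!: exI[of _ \<one>])
next
  fix x assume x: "x \<in> core"
  have "p \<otimes> inv x \<otimes> inv p = inv (p \<otimes> x \<otimes> inv p)" if "p \<in> carrier G" for p
    using that x by (simp add: core_def inv_mult_group m_assoc)
  then show "inv x \<in> core" using x by (simp add: core_def)
qed (auto simp: core_def conj_mult)

sublocale core: subgroup core G by (rule subgroup_core)

lemma core_conj:
  assumes "p \<in> carrier G" "x \<in> core"
  shows "p \<otimes> x \<otimes> inv p \<in> core"
proof -
  have x: "x \<in> carrier G" using assms(2) by (rule core.mem_carrier)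
  have "q \<otimes> (p \<otimes> x \<otimes> inv p) \<otimes> inv q \<in> H" if q: "q \<in> carrier G" for q
  proof -
    have "q \<otimes> (p \<otimes> x \<otimes> inv p) \<otimes> inv q = (q \<otimes> p) \<otimes> x \<otimes> inv (q \<otimes> p)"
      using q x assms(1) by (simp add: inv_mult_group m_assoc)
    moreover have "(q \<otimes> p) \<otimes> x \<otimes> inv (q \<otimes> p) \<in> H"
      using coreD[OF assms(2) m_closed[OF q assms(1)]] .
    ultimately show ?thesis by simp
  qed
  then show ?thesis using x assms(1) by (intro coreI) simp_all
qed

lemma group_core: "group (G\<lparr>carrier := core\<rparr>)"
  by (rule core.subgroup_is_group) (rule group_axioms)

lemma coord_hom:
  assumes p: "p \<in> carrier G"
  shows "coord p \<in> hom (G\<lparr>carrier := core\<rparr>) L"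
proof (rule homI)
  fix x assume "x \<in> carrier (G\<lparr>carrier := core\<rparr>)"
  then have "p \<otimes> x \<otimes> inv p \<in> H" using coreD p by simp
  then show "coord p x \<in> carrier L" using phi by (auto simp: coord_def hom_def)
next
  fix x y assume "x \<in> carrier (G\<lparr>carrier := core\<rparr>)" "y \<in> carrier (G\<lparr>carrier := core\<rparr>)"
  then have xy: "x \<in> core" "y \<in> core" by auto
  then have "p \<otimes> x \<otimes> inv p \<in> H" "p \<otimes> y \<otimes> inv p \<in> H" using coreD p by simp_all
  then have "\<phi> ((p \<otimes> x \<otimes> inv p) \<otimes> (p \<otimes> y \<otimes> inv p)) = \<phi> (p \<otimes> x \<otimes> inv p) \<otimes>\<^bsub>L\<^esub> \<phi> (p \<otimes> y \<otimes> inv p)"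
    using hom_mult[OF phi] by simp
  then show "coord p (x \<otimes>\<^bsub>G\<lparr>carrier := core\<rparr>\<^esub> y) = coord p x \<otimes>\<^bsub>L\<^esub> coord p y"
    using conj_mult[OF p, of x y] core.mem_carrier xy by (simp add: coord_def)
qed

lemma coord_closed: "p \<in> carrier G \<Longrightarrow> x \<in> core \<Longrightarrow> coord p x \<in> carrier L"
  using coord_hom by (fastforce simp: hom_def)

text \<open>Among the cosets \<open>H x\<^sup>i\<close> with \<open>i\<close> up to the index \<open>c\<close> two coincide, so some \<open>x\<^sup>d\<close> with \<open>1 \<le> d \<le> c\<close> lies
  in \<open>H\<close>, and \<open>d\<close> divides \<open>c!\<close>. The exponent \<open>c!\<close> does not depend on \<open>x\<close>, so it also works for all
  conjugates of \<open>x\<close>.\<close>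
lemma ex_power_in_core: "\<exists>k>0. \<forall>x\<in>carrier G. x [^] (k::nat) \<in> core"
proof -
  define c where "c = card (rcosets H)"
  have *: "x [^] (fact c :: nat) \<in> H" if x: "x \<in> carrier G" for x
  proof -
    have "(\<lambda>i::nat. H #> x [^] i) ` {..c} \<subseteq> rcosets H"
      using x by (auto intro: rcosetsI)
    from card_mono[OF H(2) this] have "\<not> inj_on (\<lambda>i::nat. H #> x [^] i) {..c}"
      unfolding c_def by (auto dest: card_image)
    then obtain i' j' :: nat where "i' \<noteq> j'" "i' \<le> c" "j' \<le> c" "H #> x [^] i' = H #> x [^] j'"
      unfolding inj_on_def by auto
    then obtain i j :: nat where ij: "i < j" "j \<le> c" "H #> x [^] i = H #> x [^] j"
      by (cases i' j' rule: linorder_cases) auto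
    have "x [^] j \<in> H #> x [^] i" unfolding ij(3) by (rule rcos_self) (simp_all add: x H(1))
    then obtain h where h: "h \<in> H" "x [^] j = h \<otimes> x [^] i" by (auto simp: r_coset_def)
    have "x [^] (j - i) \<otimes> x [^] i = h \<otimes> x [^] i" using ij x h by (simp add: nat_pow_mult)
    then have "x [^] (j - i) = h" using x h(1) by (simp add: H.mem_carrier)
    moreover have "j - i dvd (fact c :: nat)" using ij by (intro dvd_fact) auto
    then obtain d where "(fact c :: nat) = (j - i) * d" unfolding dvd_def by blast
    ultimately show ?thesis
      using h(1) x by (simp add: subgroup_nat_pow[OF H(1)] flip: nat_pow_pow)
  qed
  then show ?thesis
    by (intro exI[of _ "fact c"] conjI ballI coreI) (simp_all add: conj_nat_pow)
qed

text \<open>Let \<open>\<phi> a\<close> and \<open>\<phi> b\<close> not commute. Some powers \<open>a\<^sup>k\<close>, \<open>b\<^sup>k\<close> lie in the core, and their images under \<open>\<phi>\<close>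
  still do not commute. Their conjugates by \<open>p\<^sup>-\<^sup>1\<close> have these images in the coordinate at \<open>p\<close>.\<close>
lemma coord_nonabelian:
  assumes p: "p \<in> carrier G"
  shows "\<exists>y\<in>core. \<exists>z\<in>core. coord p y \<otimes>\<^bsub>L\<^esub> coord p z \<noteq> coord p z \<otimes>\<^bsub>L\<^esub> coord p y"
proof -
  interpret phi: group_hom "G\<lparr>carrier := H\<rparr>" L \<phi>
    using phi H.subgroup_is_group[OF group_axioms]
    by (simp add: group_hom_def group_hom_axioms_def L.group_axioms)
  obtain k :: nat where k: "k > 0" "\<And>x. x \<in> carrier G \<Longrightarrow> x [^] k \<in> core"
    using ex_power_in_core by auto
  obtain a b where ab: "a \<in> H" "b \<in> H" "\<phi> a \<otimes>\<^bsub>L\<^esub> \<phi> b \<noteq> \<phi> b \<otimes>\<^bsub>L\<^esub> \<phi> a"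
    using phi_nonabelian by blast
  define y where "y a = inv p \<otimes> a [^] k \<otimes> p" for a
  have y: "y a \<in> core" "coord p (y a) = \<phi> a [^]\<^bsub>L\<^esub> int k" if "a \<in> H" for a
  proof -
    have a: "a \<in> carrier G" using that by simp
    show "y a \<in> core" using core_conj[of "inv p" "a [^] k"] k(2)[OF a] p by (simp add: y_def)
    have "p \<otimes> y a \<otimes> inv p = a [^] k"
      unfolding y_def using p a by (simp add: m_assoc inv_cancel)
    then have "coord p (y a) = \<phi> (a [^]\<^bsub>G\<lparr>carrier := H\<rparr>\<^esub> k)"
      using that by (simp add: coord_def flip: nat_pow_consistent)
    then show "coord p (y a) = \<phi> a [^]\<^bsub>L\<^esub> int k"
      using phi.hom_nat_pow[of a k] that by (simp add: int_pow_int)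
  qed
  have "\<phi> a \<in> carrier L" "\<phi> b \<in> carrier L" using ab phi.hom_closed by auto
  from not_commute_int_pow[OF L.group_axioms L(2,1) this ab(3), of "int k" "int k"] k(1)
  show ?thesis using y[OF ab(1)] y[OF ab(2)] by (intro bexI[of _ "y a"] bexI[of _ "y b"]) auto
qed

lemma not_all_commute:
  assumes p: "p \<in> carrier G" and u: "u \<in> carrier L" "u \<noteq> \<one>\<^bsub>L\<^esub>"
  shows "{x \<in> core. coord p x \<otimes>\<^bsub>L\<^esub> u = u \<otimes>\<^bsub>L\<^esub> coord p x} \<noteq> core"
proof
  assume *: "{x \<in> core. coord p x \<otimes>\<^bsub>L\<^esub> u = u \<otimes>\<^bsub>L\<^esub> coord p x} = core"
  have "coord p y \<otimes>\<^bsub>L\<^esub> coord p z = coord p z \<otimes>\<^bsub>L\<^esub> coord p y" if "y \<in> core" "z \<in> core" for y z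
  proof -
    have "coord p y \<otimes>\<^bsub>L\<^esub> u = u \<otimes>\<^bsub>L\<^esub> coord p y" "u \<otimes>\<^bsub>L\<^esub> coord p z = coord p z \<otimes>\<^bsub>L\<^esub> u"
      using * that by force+
    then show ?thesis
      using L(1) u coord_closed[OF p that(1)] coord_closed[OF p that(2)]
      unfolding commutation_transitive_def by blast
  qed
  with coord_nonabelian[OF p] show False by blast
qed

text \<open>The generators are chosen one after the other. For the next one, \<open>n\<close>, the conditions to avoid are that
  the coordinate of \<open>n\<close> at some \<open>p\<close> is trivial or commutes with the coordinate at some \<open>q\<close> of an earlier
  generator. Each describes a subgroup of the core that is isolated, and that is proper because
  every coordinate has nonabelian image.\<close>
lemma ex_generic_family:
  assumes "finite X" "finite P" "P \<subseteq> carrier G"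
  shows "\<exists>g. (\<forall>x\<in>X. g x \<in> core \<and> (\<forall>p\<in>P. coord p (g x) \<noteq> \<one>\<^bsub>L\<^esub>)) \<and>
    (\<forall>x\<in>X. \<forall>y\<in>X. x \<noteq> y \<longrightarrow> (\<forall>p\<in>P. \<forall>q\<in>P.
       coord p (g x) \<otimes>\<^bsub>L\<^esub> coord q (g y) \<noteq> coord q (g y) \<otimes>\<^bsub>L\<^esub> coord p (g x)))"
  using assms(1)
proof (induction X rule: finite_induct)
  case (insert x X)
  then obtain g where gX: "\<forall>x\<in>X. g x \<in> core \<and> (\<forall>p\<in>P. coord p (g x) \<noteq> \<one>\<^bsub>L\<^esub>)"
    "\<forall>x\<in>X. \<forall>y\<in>X. x \<noteq> y \<longrightarrow> (\<forall>p\<in>P. \<forall>q\<in>P.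
       coord p (g x) \<otimes>\<^bsub>L\<^esub> coord q (g y) \<noteq> coord q (g y) \<otimes>\<^bsub>L\<^esub> coord p (g x))"
    by (elim exE conjE)
  have g: "\<And>y. y \<in> X \<Longrightarrow> g y \<in> core"
    "\<And>y p. y \<in> X \<Longrightarrow> p \<in> P \<Longrightarrow> coord p (g y) \<noteq> \<one>\<^bsub>L\<^esub>"
    "\<And>y z p q. y \<in> X \<Longrightarrow> z \<in> X \<Longrightarrow> y \<noteq> z \<Longrightarrow> p \<in> P \<Longrightarrow> q \<in> P \<Longrightarrow>
       coord p (g y) \<otimes>\<^bsub>L\<^esub> coord q (g z) \<noteq> coord q (g z) \<otimes>\<^bsub>L\<^esub> coord p (g y)"
    using gX by simp_all
  have PG: "p \<in> carrier G" if "p \<in> P" for p using assms that by blast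
  interpret N: group "G\<lparr>carrier := core\<rparr>" by (rule group_core)
  define K where "K p = {n \<in> core. coord p n \<in> {\<one>\<^bsub>L\<^esub>}}" for p
  define Z where "Z = (\<lambda>(p, q, y). {n \<in> core. coord p n \<in>
      {l \<in> carrier L. l \<otimes>\<^bsub>L\<^esub> coord q (g y) = coord q (g y) \<otimes>\<^bsub>L\<^esub> l}})"
  have "\<exists>n\<in>carrier (G\<lparr>carrier := core\<rparr>). \<forall>C\<in>K ` P \<union> Z ` (P \<times> P \<times> X). n \<notin> C"
  proof (rule N.avoid_isolated_subgroups)
    show "finite (K ` P \<union> Z ` (P \<times> P \<times> X))" using assms insert.hyps by simp
    fix C assume "C \<in> K ` P \<union> Z ` (P \<times> P \<times> X)"
    then show "isolated_subgroup C (G\<lparr>carrier := core\<rparr>) \<and> C \<noteq> carrier (G\<lparr>carrier := core\<rparr>)"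
    proof (elim UnE imageE; clarify)
      fix p assume p: "p \<in> P" and "C = K p"
      have "isolated_subgroup (K p) (G\<lparr>carrier := core\<rparr>)"
        using isolated_subgroup_preimage[OF group_core L.group_axioms coord_hom[OF PG[OF p]]
            big_powers_torsion_free[OF L.group_axioms L(2)]]
        by (simp add: K_def)
      moreover have "K p \<noteq> core"
      proof
        assume "K p = core"
        then have "coord p y = \<one>\<^bsub>L\<^esub>" if "y \<in> core" for y using that by (auto simp: K_def)
        then show False using coord_nonabelian[OF PG[OF p]] by auto
      qed
      ultimately show "isolated_subgroup (K p) (G\<lparr>carrier := core\<rparr>) \<and>
          K p \<noteq> carrier (G\<lparr>carrier := core\<rparr>)" by simp
    next
      fix p q y assume *: "p \<in> P" "q \<in> P" "y \<in> X"
      have u: "coord q (g y) \<in> carrier L" using * g PG by (simp add: coord_closed)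
      have "isolated_subgroup (Z (p, q, y)) (G\<lparr>carrier := core\<rparr>)"
        using isolated_subgroup_preimage[OF group_core L.group_axioms coord_hom[OF PG[OF *(1)]]
            isolated_centralizer[OF L.group_axioms L(2,1) u]]
        by (simp add: Z_def)
      moreover have "Z (p, q, y) \<noteq> core"
        using not_all_commute[OF PG[OF *(1)] u g(2)[OF *(3,2)]] coord_closed[OF PG[OF *(1)]]
        unfolding Z_def by auto
      ultimately show "isolated_subgroup (Z (p, q, y)) (G\<lparr>carrier := core\<rparr>) \<and>
          Z (p, q, y) \<noteq> carrier (G\<lparr>carrier := core\<rparr>)" by simp
    qed
  qed
  then obtain n where n: "n \<in> core" "\<And>p. p \<in> P \<Longrightarrow> n \<notin> K p"
      "\<And>p q y. p \<in> P \<Longrightarrow> q \<in> P \<Longrightarrow> y \<in> X \<Longrightarrow> n \<notin> Z (p, q, y)"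
    by fastforce
  have n1: "coord p n \<noteq> \<one>\<^bsub>L\<^esub>" if "p \<in> P" for p using n that by (auto simp: K_def)
  have n2: "coord p n \<otimes>\<^bsub>L\<^esub> coord q (g y) \<noteq> coord q (g y) \<otimes>\<^bsub>L\<^esub> coord p n"
    if "p \<in> P" "q \<in> P" "y \<in> X" for p q y
    using n(3)[OF that] n(1) PG[OF that(1)] by (auto simp: Z_def coord_closed)
  show ?case
    using insert.hyps(2) g n(1) n1 n2 n2[symmetric]
    by (intro exI[of _ "g(x := n)"]) auto
qed auto

end

section \<open>Products of syllables\<close>

text \<open>The syllable \<open>(q, x, e)\<close> stands for \<open>q x\<^sup>e\<close>, where \<open>q\<close> is a letter over the original generators or, in
  the case \<open>None\<close>, the identity.\<close>
type_synonym ('a, 'i) syllable = "'a letter option \<times> 'i \<times> int"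

abbreviation base :: "('a, 'i) syllable \<Rightarrow> 'i" where
  "base t \<equiv> fst (snd t)"

definition separator_value :: "('a, 'b) monoid_scheme \<Rightarrow> 'a letter option \<Rightarrow> 'a" where
  "separator_value G q = (case q of None \<Rightarrow> \<one>\<^bsub>G\<^esub> | Some l \<Rightarrow> letter_value G l)"

fun syllables_value :: "('a, 'b) monoid_scheme \<Rightarrow> ('i \<Rightarrow> 'a) \<Rightarrow> ('a, 'i) syllable list \<Rightarrow> 'a" where
  "syllables_value G g [] = \<one>\<^bsub>G\<^esub>"
| "syllables_value G g ((q, x, e) # ts) =
     separator_value G q \<otimes>\<^bsub>G\<^esub> (g x [^]\<^bsub>G\<^esub> e \<otimes>\<^bsub>G\<^esub> syllables_value G g ts)"

text \<open>The bases of neighbouring syllables are required to differ even where a letter \<open>q\<close>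
  separates them.\<close>
definition alternating :: "('a, 'i) syllable list \<Rightarrow> bool" where
  "alternating ts \<longleftrightarrow>
     (\<forall>t\<in>set ts. snd (snd t) \<noteq> 0) \<and> successively (\<lambda>s t. base s \<noteq> base t) ts"

definition syllables_over :: "'a set \<Rightarrow> 'i set \<Rightarrow> ('a, 'i) syllable list \<Rightarrow> bool" where
  "syllables_over S X ts \<longleftrightarrow>
     (\<forall>(q, x, e)\<in>set ts. x \<in> X \<and> (\<forall>l. q = Some l \<longrightarrow> fst l \<in> S))"

lemma syllables_over_Cons [simp]:
  "syllables_over S X ((q, x, e) # ts) \<longleftrightarrow>
     x \<in> X \<and> (\<forall>l. q = Some l \<longrightarrow> fst l \<in> S) \<and> syllables_over S X ts"
  "syllables_over S X []"
  by (auto simp: syllables_over_def)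

lemma alternating_simps [simp]:
  "alternating []" "alternating [t] \<longleftrightarrow> snd (snd t) \<noteq> 0"
  "alternating (s # t # ts) \<longleftrightarrow> snd (snd s) \<noteq> 0 \<and> base s \<noteq> base t \<and> alternating (t # ts)"
  by (auto simp: alternating_def)

lemma alternating_tl: "alternating (t # ts) \<Longrightarrow> alternating ts"
  by (cases ts) auto

lemma (in group) separator_value_closed:
  "\<forall>l. q = Some l \<longrightarrow> fst l \<in> carrier G \<Longrightarrow> separator_value G q \<in> carrier G"
  by (auto simp: separator_value_def letter_value_def split: option.split)

lemma (in group) syllables_value_closed:
  assumes "S \<subseteq> carrier G" "\<And>x. x \<in> X \<Longrightarrow> g x \<in> carrier G" "syllables_over S X ts"
  shows "syllables_value G g ts \<in> carrier G"
  using assms(3)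
proof (induction ts)
  case (Cons t ts)
  obtain q x e where t: "t = (q, x, e)" by (metis prod_cases3)
  have "separator_value G q \<in> carrier G" using Cons.prems assms t by (intro separator_value_closed) auto
  then show ?case using Cons assms t by auto
qed simp

fun prefix_values :: "('a, 'b) monoid_scheme \<Rightarrow> 'a \<Rightarrow> ('a, 'i) syllable list \<Rightarrow> 'a list" where
  "prefix_values G p [] = [p]"
| "prefix_values G p ((q, x, e) # ts) = (let p' = p \<otimes>\<^bsub>G\<^esub> separator_value G q in p' # prefix_values G p' ts)"

lemma (in group) prefix_values_closed:
  assumes "S \<subseteq> carrier G" "p \<in> carrier G" "syllables_over S X ts"
  shows "set (prefix_values G p ts) \<subseteq> carrier G"
  using assms(2,3)
proof (induction ts arbitrary: p)
  case (Cons t ts)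
  obtain q x e where t: "t = (q, x, e)" by (metis prod_cases3)
  have "separator_value G q \<in> carrier G" using Cons.prems assms t by (intro separator_value_closed) auto
  then show ?case using Cons assms t by (simp add: Let_def)
qed simp

context virtual_hom
begin

fun coord_syllables :: "('i \<Rightarrow> 'a) \<Rightarrow> 'a \<Rightarrow> ('a, 'i) syllable list \<Rightarrow> 'c list" where
  "coord_syllables g p [] = []"
| "coord_syllables g p ((q, x, e) # ts) =
     (let p' = p \<otimes> separator_value G q in coord p' (g x) [^]\<^bsub>L\<^esub> e # coord_syllables g p' ts)"

lemma coord_power:
  assumes "p \<in> carrier G" "x \<in> core"
  shows "coord p ((x [^] (n::nat)) [^] (e::int)) = (coord p x [^]\<^bsub>L\<^esub> e) [^]\<^bsub>L\<^esub> n"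
    and "(x [^] n) [^] e \<in> core"
proof -
  interpret c: group_hom "G\<lparr>carrier := core\<rparr>" L "coord p"
    using coord_hom[OF assms(1)] group_core
    by (simp add: group_hom_def group_hom_axioms_def L.group_axioms)
  let ?N = "G\<lparr>carrier := core\<rparr>"
  have x: "x \<in> carrier ?N" using assms(2) by simp
  have xn: "x [^] n \<in> core" by (rule subgroup_nat_pow[OF subgroup_core assms(2)])
  have eq: "(x [^] n) [^] e = (x [^]\<^bsub>?N\<^esub> n) [^]\<^bsub>?N\<^esub> e"
    unfolding int_pow_consistent[OF subgroup_core xn] by (simp only: nat_pow_consistent[of x n core])
  have "(x [^]\<^bsub>?N\<^esub> n) [^]\<^bsub>?N\<^esub> e \<in> carrier ?N" by (intro c.int_pow_closed c.nat_pow_closed x)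
  then show "(x [^] n) [^] e \<in> core" unfolding eq by simp
  have "coord p ((x [^] n) [^] e) = (coord p x [^]\<^bsub>L\<^esub> n) [^]\<^bsub>L\<^esub> e"
    unfolding eq c.hom_int_pow[OF c.nat_pow_closed[OF x]] c.hom_nat_pow[OF x] ..
  also have "\<dots> = (coord p x [^]\<^bsub>L\<^esub> e) [^]\<^bsub>L\<^esub> n"
    unfolding int_pow_int[symmetric]
    by (simp only: L.int_pow_pow[OF coord_closed[OF assms]] mult.commute)
  finally show "coord p ((x [^] n) [^] e) = (coord p x [^]\<^bsub>L\<^esub> e) [^]\<^bsub>L\<^esub> n" .
qed

text \<open>This moves the separators to the end of the word:
  \<open>p q x\<^sup>e v = (s x\<^sup>e s\<^sup>-\<^sup>1) s v\<close> with \<open>s = p q\<close>, and the conjugate lies in \<open>H\<close> because \<open>x\<close> is in the core. What remains in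
  the end is the full product \<open>p'\<close> of the separators.\<close>
lemma phi_syllables_value:
  fixes n :: nat
  assumes S: "S \<subseteq> carrier G" and g: "\<And>x. x \<in> X \<Longrightarrow> g x \<in> core"
    and "p \<in> carrier G" "syllables_over S X ts" "p' = last (prefix_values G p ts)"
  shows "(p \<otimes> syllables_value G (\<lambda>x. g x [^] n) ts \<in> H \<longleftrightarrow> p' \<in> H) \<and>
    (p' \<in> H \<longrightarrow> \<phi> (p \<otimes> syllables_value G (\<lambda>x. g x [^] n) ts) = foldr (\<lambda>k h. k [^]\<^bsub>L\<^esub> n \<otimes>\<^bsub>L\<^esub> h) (coord_syllables g p ts) (\<phi> p'))"
  using assms(3-)
proof (induction ts arbitrary: p)
  case (Cons t ts)
  obtain q x e where t: "t = (q, x, e)" by (metis prod_cases3)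
  define s where "s = p \<otimes> separator_value G q"
  define y where "y = (g x [^] n) [^] e"
  define z where "z = syllables_value G (\<lambda>x. g x [^] n) ts"
  have x: "x \<in> X" and over: "syllables_over S X ts" and sep: "separator_value G q \<in> carrier G"
    using Cons.prems(2) S t by (auto intro!: separator_value_closed)
  have s: "s \<in> carrier G" using sep Cons.prems by (simp add: s_def)
  have y: "y \<in> core" "coord s y = (coord s (g x) [^]\<^bsub>L\<^esub> e) [^]\<^bsub>L\<^esub> n"
    unfolding y_def using coord_power[OF s g[OF x]] by auto
  have z: "z \<in> carrier G"
    unfolding z_def using S over core.mem_carrier[OF g] by (intro syllables_value_closed[of S X]) auto
  define k where "k = s \<otimes> y \<otimes> inv s"
  have k: "k \<in> H" using coreD[OF y(1) s] by (simp add: k_def)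
  have pq: "p' = last (prefix_values G s ts)"
    using Cons.prems(3) t by (cases ts) (auto simp: s_def Let_def)
  have "p \<otimes> syllables_value G (\<lambda>x. g x [^] n) (t # ts) = s \<otimes> (y \<otimes> z)"
    using sep y(1) z Cons.prems(1) by (simp add: t s_def y_def[symmetric] z_def[symmetric] m_assoc)
  also have "\<dots> = s \<otimes> y \<otimes> (inv s \<otimes> s) \<otimes> z" using s y z by (simp add: m_assoc)
  also have "\<dots> = k \<otimes> (s \<otimes> z)" using s y z by (simp add: k_def m_assoc inv_cancel)
  finally have eq: "p \<otimes> syllables_value G (\<lambda>x. g x [^] n) (t # ts) = k \<otimes> (s \<otimes> z)" .
  note IH = Cons.IH[OF s over pq, folded z_def]
  have sz: "s \<otimes> z \<in> carrier G" using s z by simp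
  have "k \<otimes> (s \<otimes> z) \<in> H \<longleftrightarrow> s \<otimes> z \<in> H"
  proof
    assume "k \<otimes> (s \<otimes> z) \<in> H"
    then have "inv k \<otimes> (k \<otimes> (s \<otimes> z)) \<in> H" using k by blast
    then show "s \<otimes> z \<in> H" using k sz H.mem_carrier[OF k] by (simp flip: m_assoc)
  qed (use k in blast)
  moreover have "\<phi> (k \<otimes> (s \<otimes> z)) = \<phi> k \<otimes>\<^bsub>L\<^esub> \<phi> (s \<otimes> z)" if "s \<otimes> z \<in> H"
    using phi k that by (auto simp: hom_def)
  moreover have "\<phi> k = (coord s (g x) [^]\<^bsub>L\<^esub> e) [^]\<^bsub>L\<^esub> n" using y(2) by (simp add: k_def coord_def)
  ultimately show ?case unfolding eq using IH by (auto simp: t Let_def s_def[symmetric])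
qed auto

text \<open>Passing from \<open>g x\<close> to its power with a nonzero exponent preserves nontriviality and
  noncommutation, as \<open>{\<one>}\<close> and centralizers are isolated.\<close>
lemma successively_coord_syllables:
  assumes P: "P \<subseteq> carrier G"
    and g: "\<And>x. x \<in> X \<Longrightarrow> g x \<in> core" "\<And>x p. x \<in> X \<Longrightarrow> p \<in> P \<Longrightarrow> coord p (g x) \<noteq> \<one>\<^bsub>L\<^esub>"
      "\<And>x y p q. x \<in> X \<Longrightarrow> y \<in> X \<Longrightarrow> x \<noteq> y \<Longrightarrow> p \<in> P \<Longrightarrow> q \<in> P \<Longrightarrow>
         coord p (g x) \<otimes>\<^bsub>L\<^esub> coord q (g y) \<noteq> coord q (g y) \<otimes>\<^bsub>L\<^esub> coord p (g x)"
    and "set (prefix_values G p ts) \<subseteq> P" "syllables_over S X ts" "alternating ts"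
  shows "set (coord_syllables g p ts) \<subseteq> carrier L - {\<one>\<^bsub>L\<^esub>} \<and>
    successively (\<lambda>k l. k \<otimes>\<^bsub>L\<^esub> l \<noteq> l \<otimes>\<^bsub>L\<^esub> k) (coord_syllables g p ts)"
  using assms(5-)
proof (induction ts arbitrary: p)
  case (Cons t ts)
  obtain q x e where t: "t = (q, x, e)" by (metis prod_cases3)
  define s where "s = p \<otimes> separator_value G q"
  have sP: "s \<in> P" and pre: "set (prefix_values G s ts) \<subseteq> P" and x: "x \<in> X"
    and over: "syllables_over S X ts" and alt: "alternating ts" and e: "e \<noteq> 0"
    using Cons.prems alternating_tl[of t ts] by (auto simp: t s_def Let_def alternating_def)
  have s: "s \<in> carrier G" using P sP by blast
  have c: "coord s (g x) \<in> carrier L" using s g x by (simp add: coord_closed)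
  have "coord s (g x) [^]\<^bsub>L\<^esub> e \<noteq> \<one>\<^bsub>L\<^esub>"
    using isolated_subgroup_int_pow[OF L.group_axioms big_powers_torsion_free[OF L.group_axioms L(2)] c, of e]
      e g(2)[OF x sP] by auto
  moreover have "coord s (g x) [^]\<^bsub>L\<^esub> e \<otimes>\<^bsub>L\<^esub> l \<noteq> l \<otimes>\<^bsub>L\<^esub> coord s (g x) [^]\<^bsub>L\<^esub> e"
    if Cons_eq: "coord_syllables g s ts = l # ls" for l ls
  proof -
    obtain q' x' e' ts' where ts: "ts = (q', x', e') # ts'"
      using Cons_eq by (cases ts) auto
    define s' where "s' = s \<otimes> separator_value G q'"
    have l: "l = coord s' (g x') [^]\<^bsub>L\<^esub> e'" using Cons_eq by (simp add: ts Let_def s'_def)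
    have *: "s' \<in> P" "x' \<in> X" "e' \<noteq> 0" "x \<noteq> x'"
      using pre over alt Cons.prems(3) by (auto simp: t ts Let_def s'_def alternating_def)
    then have "coord s' (g x') \<in> carrier L" using P g by (intro coord_closed) auto
    from not_commute_int_pow[OF L.group_axioms L(2,1) c this g(3)[OF x *(2,4) sP *(1)] e *(3)]
    show ?thesis by (simp add: l)
  qed
  ultimately show ?case
    using Cons.IH[OF pre over alt] c
    by (cases "coord_syllables g s ts") (auto simp: t Let_def s_def[symmetric])
qed simp

text \<open>Take a generic family \<open>g\<close> for the finite set \<open>P\<close> of all prefixes that occur in \<open>\<T>\<close>, and replace
  each \<open>g x\<close> by a high power. If the product \<open>p'\<close> of the separators of some \<open>ts\<close> is outside \<open>H\<close>, then so is the value
  of \<open>ts\<close>; otherwise \<open>\<phi>\<close> of the value is a product of big powers in \<open>L\<close>.\<close>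
lemma ex_independent_family:
  assumes "finite X" "finite \<T>" "S \<subseteq> carrier G"
    and \<T>: "\<And>ts. ts \<in> \<T> \<Longrightarrow> ts \<noteq> [] \<and> alternating ts \<and> syllables_over S X ts"
  shows "\<exists>g. (\<forall>x\<in>X. g x \<in> carrier G) \<and> (\<forall>ts\<in>\<T>. syllables_value G g ts \<noteq> \<one>)"
proof -
  define P where "P = (\<Union>ts\<in>\<T>. set (prefix_values G \<one> ts))"
  have P: "finite P" "P \<subseteq> carrier G"
    using assms prefix_values_closed[OF assms(3), of \<one>] unfolding P_def by blast+
  obtain g where g: "\<And>x. x \<in> X \<Longrightarrow> g x \<in> core"
      "\<And>x p. x \<in> X \<Longrightarrow> p \<in> P \<Longrightarrow> coord p (g x) \<noteq> \<one>\<^bsub>L\<^esub>"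
      "\<And>x y p q. x \<in> X \<Longrightarrow> y \<in> X \<Longrightarrow> x \<noteq> y \<Longrightarrow> p \<in> P \<Longrightarrow> q \<in> P \<Longrightarrow>
         coord p (g x) \<otimes>\<^bsub>L\<^esub> coord q (g y) \<noteq> coord q (g y) \<otimes>\<^bsub>L\<^esub> coord p (g x)"
    using ex_generic_family[OF assms(1) P] by metis
  \<comment> \<open>a condition that holds for all large \<open>n\<close> can be met for finitely many \<open>ts\<close> at once\<close>
  have "eventually (\<lambda>n. syllables_value G (\<lambda>x. g x [^] n) ts \<noteq> \<one>) sequentially" if "ts \<in> \<T>" for ts
  proof -
    note ts = \<T>[OF that]
    define p' where "p' = last (prefix_values G \<one> ts)"
    have v: "syllables_value G (\<lambda>x. g x [^] n) ts \<in> carrier G" for n :: nat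
      using core.mem_carrier[OF g(1)] ts assms(3) by (intro syllables_value_closed[of S X]) auto
    have phi1: "\<phi> \<one> = \<one>\<^bsub>L\<^esub>"
      using hom_one[OF phi H.subgroup_is_group[OF group_axioms] L.group_axioms] by simp
    have *: "syllables_value G (\<lambda>x. g x [^] n) ts \<in> H \<longleftrightarrow> p' \<in> H"
      "p' \<in> H \<Longrightarrow> \<phi> (syllables_value G (\<lambda>x. g x [^] n) ts) =
        foldr (\<lambda>k h. k [^]\<^bsub>L\<^esub> n \<otimes>\<^bsub>L\<^esub> h) (coord_syllables g \<one> ts) (\<phi> p')" for n :: nat
      using phi_syllables_value[where X = X and n = n and g = g, OF assms(3) g(1) one_closed _ p'_def] ts v[of n] by simp_all
    show ?thesis
    proof (cases "p' \<in> H")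
      case False
      have "syllables_value G (\<lambda>x. g x [^] n) ts \<noteq> \<one>" for n :: nat
      proof
        assume "syllables_value G (\<lambda>x. g x [^] n) ts = \<one>"
        with *(1)[of n] False show False by simp
      qed
      then show ?thesis by simp
    next
      case True
      have "set (prefix_values G \<one> ts) \<subseteq> P" using that by (auto simp: P_def)
      then have succ: "set (coord_syllables g \<one> ts) \<subseteq> carrier L - {\<one>\<^bsub>L\<^esub>} \<and>
          successively (\<lambda>k l. k \<otimes>\<^bsub>L\<^esub> l \<noteq> l \<otimes>\<^bsub>L\<^esub> k) (coord_syllables g \<one> ts)"
        using ts by (intro successively_coord_syllables[OF P(2) g]) auto
      have "coord_syllables g \<one> ts \<noteq> []" using ts by (cases ts) (auto simp: Let_def)
      moreover have "\<phi> p' \<in> carrier L" using True phi by (auto simp: hom_def)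
      ultimately have "eventually (\<lambda>n::nat. foldr (\<lambda>k h. k [^]\<^bsub>L\<^esub> n \<otimes>\<^bsub>L\<^esub> h)
          (coord_syllables g \<one> ts) (\<phi> p') \<noteq> \<one>\<^bsub>L\<^esub>) sequentially"
        using L(2) succ unfolding big_powers_def by blast
      then show ?thesis
      proof (rule eventually_mono)
        fix n :: nat
        assume "foldr (\<lambda>k h. k [^]\<^bsub>L\<^esub> n \<otimes>\<^bsub>L\<^esub> h) (coord_syllables g \<one> ts) (\<phi> p') \<noteq> \<one>\<^bsub>L\<^esub>"
        then have "\<phi> (syllables_value G (\<lambda>x. g x [^] n) ts) \<noteq> \<phi> \<one>"
          unfolding *(2)[OF True] phi1 .
        then show "syllables_value G (\<lambda>x. g x [^] n) ts \<noteq> \<one>" by metis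
      qed
    qed
  qed
  then have "eventually (\<lambda>n. \<forall>ts\<in>\<T>. syllables_value G (\<lambda>x. g x [^] n) ts \<noteq> \<one>) sequentially"
    using assms(2) by (simp add: eventually_ball_finite)
  then obtain n :: nat where "\<forall>ts\<in>\<T>. syllables_value G (\<lambda>x. g x [^] n) ts \<noteq> \<one>"
    by (auto simp: eventually_sequentially)
  then show ?thesis using core.mem_carrier[OF g(1)] by (intro exI[of _ "\<lambda>x. g x [^] n"]) auto
qed

end

section \<open>Short words expand to alternating products of syllables\<close>

text \<open>Names for the new generators: \<open>Inl (s, True)\<close> and \<open>Inl (s, False)\<close> for the two elements \<open>a\<close> and \<open>b\<close> attached
  to \<open>s\<close>, and \<open>Inr s\<close> for \<open>a\<^sup>M s b\<^sup>M\<close>. Flagging \<open>a\<close> and \<open>b\<close> by \<open>True\<close> and \<open>False\<close> treats \<open>Inr s\<close> and its inverse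
  \<open>b\<^sup>-\<^sup>M s\<^sup>-\<^sup>1 a\<^sup>-\<^sup>M\<close> alike: the letter \<open>(Inr s, b)\<close> is the power of \<open>(s, b)\<close>, the letter \<open>(s, b)\<close>, the
  power of \<open>(s, \<not> b)\<close>, and both exponents are \<open>M\<close> with the sign of \<open>b\<close>.\<close>
type_synonym 'a gen = "'a letter + 'a"

fun push :: "'i \<Rightarrow> int \<Rightarrow> ('a, 'i) syllable list \<Rightarrow> ('a, 'i) syllable list" where
  "push x e [] = [(None, x, e)]"
| "push x e ((q, y, d) # ts) =
     (if q = None \<and> y = x then (None, x, e + d) # ts else (None, x, e) # (q, y, d) # ts)"

text \<open>Multiplication by \<open>l\<close> from the left, for products whose first syllable has no separator; \<open>push\<close> always
  yields such a product.\<close>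
fun mark :: "'a letter \<Rightarrow> ('a, 'i) syllable list \<Rightarrow> ('a, 'i) syllable list" where
  "mark l [] = []"
| "mark l ((q, x, e) # ts) = (Some l, x, e) # ts"

definition sgn_of :: "bool \<Rightarrow> int" where
  "sgn_of b = (if b then 1 else - 1)"

fun prepend_letter :: "int \<Rightarrow> 'a gen letter \<Rightarrow> ('a, 'a letter) syllable list \<Rightarrow> ('a, 'a letter) syllable list" where
  "prepend_letter M (Inl x, b) ts = push x (sgn_of b) ts"
| "prepend_letter M (Inr s, b) ts =
     (None, (s, b), sgn_of b * M) # mark (s, b) (push (s, \<not> b) (sgn_of b * M) ts)"

definition syllables :: "int \<Rightarrow> 'a gen letter list \<Rightarrow> ('a, 'a letter) syllable list" where
  "syllables M w = foldr (prepend_letter M) w []"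

lemma syllables_simps [simp]:
  "syllables M [] = []" "syllables M (l # w) = prepend_letter M l (syllables M w)"
  by (simp_all add: syllables_def)

definition gen_value :: "('a, 'b) monoid_scheme \<Rightarrow> int \<Rightarrow> ('a letter \<Rightarrow> 'a) \<Rightarrow> 'a gen \<Rightarrow> 'a" where
  "gen_value G M g i = (case i of Inl x \<Rightarrow> g x
     | Inr s \<Rightarrow> g (s, True) [^]\<^bsub>G\<^esub> M \<otimes>\<^bsub>G\<^esub> (s \<otimes>\<^bsub>G\<^esub> g (s, False) [^]\<^bsub>G\<^esub> M))"

definition gens :: "'a set \<Rightarrow> 'a gen set" where
  "gens S = (S \<times> UNIV) <+> S"

lemma syllables_over_push:
  "x \<in> X \<Longrightarrow> syllables_over S X ts \<Longrightarrow> syllables_over S X (push x e ts)"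
  by (cases "(x, e, ts)" rule: push.cases) auto

lemma syllables_over_mark:
  "fst l \<in> S \<Longrightarrow> syllables_over S X ts \<Longrightarrow> syllables_over S X (mark l ts)"
  by (cases "(l, ts)" rule: mark.cases) auto

lemma syllables_over_syllables:
  "w \<in> words (gens S) \<Longrightarrow> syllables_over S (S \<times> UNIV) (syllables M w)"
proof (induction w)
  case (Cons l w)
  then show ?case
    by (cases "(M, l, syllables M w)" rule: prepend_letter.cases)
       (auto simp: gens_def intro!: syllables_over_push syllables_over_mark)
qed simp

lemma push_Cons: "\<exists>e' ts'. push x e ts = (None, x, e') # ts'"
  by (cases "(x, e, ts)" rule: push.cases) auto

context group
begin

context
  fixes S :: "'a set" and X :: "'i set" and g :: "'i \<Rightarrow> 'a"
  assumes S: "S \<subseteq> carrier G" and g: "\<And>x. x \<in> X \<Longrightarrow> g x \<in> carrier G"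
begin

lemma syllables_value_push:
  assumes "x \<in> X" "syllables_over S X ts"
  shows "syllables_value G g (push x e ts) = g x [^] e \<otimes> syllables_value G g ts"
proof (cases "(x, e, ts)" rule: push.cases)
  case (2 _ _ q y d ts')
  then have "syllables_value G g ts' \<in> carrier G"
    using S g assms by (intro syllables_value_closed[of S X]) auto
  moreover have "separator_value G q \<in> carrier G"
    using 2 S assms by (auto intro!: separator_value_closed)
  ultimately show ?thesis using 2 g assms
    by (auto simp: separator_value_def int_pow_mult m_assoc)
qed (use g assms in \<open>simp add: separator_value_def\<close>)

lemma syllables_value_mark:
  assumes "fst l \<in> S" "syllables_over S X ts" "ts = (None, x, e) # ts'"
  shows "syllables_value G g (mark l ts) = letter_value G l \<otimes> syllables_value G g ts"
proof -
  have "syllables_value G g ts' \<in> carrier G" "g x \<in> carrier G"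
    using S g assms by (auto intro!: syllables_value_closed[of S X])
  then show ?thesis using assms by (simp add: separator_value_def)
qed

end

lemma syllables_value_syllables:
  assumes S: "S \<subseteq> carrier G" and g: "\<And>x. x \<in> S \<times> UNIV \<Longrightarrow> g x \<in> carrier G"
    and w: "w \<in> words (gens S)"
  shows "syllables_value G g (syllables M w) = word_value G (rename (gen_value G M g) w)"
  using w
proof (induction w)
  case (Cons l w)
  let ?v = "syllables_value G g"
  let ?ts = "syllables M w"
  have over: "syllables_over S (S \<times> UNIV) ?ts" using Cons.prems by (simp add: syllables_over_syllables)
  have closed: "?v ts \<in> carrier G" if "syllables_over S (S \<times> UNIV) ts" for ts
    by (rule syllables_value_closed[OF S _ that]) (rule g)
  have push: "?v (push x e ts) = g x [^] e \<otimes> ?v ts"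
    if "x \<in> S \<times> UNIV" "syllables_over S (S \<times> UNIV) ts" for x e ts
    by (rule syllables_value_push[OF S _ that]) (rule g)
  have v: "?v ?ts \<in> carrier G" using over by (rule closed)
  have "?v (prepend_letter M l ?ts) = letter_value G (gen_value G M g (fst l), snd l) \<otimes> ?v ?ts"
  proof (cases l)
    case (Pair i b)
    show ?thesis
    proof (cases i)
      case (Inl x)
      then have x: "x \<in> S \<times> UNIV" using Cons.prems Pair by (auto simp: gens_def)
      have "g x [^] sgn_of b = letter_value G (g x, b)"
        using g[OF x] by (simp add: sgn_of_def letter_value_def int_pow_neg)
      then show ?thesis
        using push[OF x over] by (simp add: Pair Inl gen_value_def)
    next
      case (Inr s)
      then have s: "s \<in> S" using Cons.prems Pair by (auto simp: gens_def)
      then have sG: "s \<in> carrier G" using S by blast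
      have gs: "g (s, c) \<in> carrier G" for c using g s by simp
      obtain e' ts' where p: "push (s, \<not> b) (sgn_of b * M) ?ts = (None, (s, \<not> b), e') # ts'"
        using push_Cons[of "(s, \<not> b)" "sgn_of b * M" ?ts] by auto
      have po: "syllables_over S (S \<times> UNIV) (push (s, \<not> b) (sgn_of b * M) ?ts)"
        using s over by (intro syllables_over_push) auto
      have "?v (prepend_letter M l ?ts) = g (s, b) [^] (sgn_of b * M) \<otimes>
          (letter_value G (s, b) \<otimes> (g (s, \<not> b) [^] (sgn_of b * M) \<otimes> ?v ?ts))"
      proof -
        have "?v (mark (s, b) (push (s, \<not> b) (sgn_of b * M) ?ts)) =
            letter_value G (s, b) \<otimes> ?v (push (s, \<not> b) (sgn_of b * M) ?ts)"
          by (rule syllables_value_mark[OF S _ _ po p]) (use g s in auto)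
        moreover have "?v (push (s, \<not> b) (sgn_of b * M) ?ts) = g (s, \<not> b) [^] (sgn_of b * M) \<otimes> ?v ?ts"
          using s over by (intro push) auto
        moreover have "letter_value G (s, b) \<in> carrier G" using sG by (simp add: letter_value_def)
        ultimately show ?thesis using gs v by (simp add: Pair Inr separator_value_def)
      qed
      also have "\<dots> = letter_value G (gen_value G M g (fst l), snd l) \<otimes> ?v ?ts"
        using sG gs v
        by (cases b) (simp_all add: Pair Inr letter_value_def gen_value_def sgn_of_def m_assoc
            inv_mult_group int_pow_neg)
      finally show ?thesis .
    qed
  qed
  then show ?case using Cons by (simp add: word_value_def)
qed (simp add: word_value_def)

end

lemma alternating_push:
  assumes "alternating ts" "e \<noteq> 0" "\<And>d ts'. ts = (None, x, d) # ts' \<Longrightarrow> e + d \<noteq> 0"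
    "\<And>q y d ts'. ts = (q, y, d) # ts' \<Longrightarrow> q = None"
  shows "alternating (push x e ts)"
proof (cases "(x, e, ts)" rule: push.cases)
  case (2 _ _ q y d ts')
  then show ?thesis using assms by (cases ts') auto
qed (use assms in auto)

lemma alternating_mark: "alternating (mark l ts) \<longleftrightarrow> alternating ts"
proof (cases "(l, ts)" rule: mark.cases)
  case (2 _ q y d ts')
  then show ?thesis by (cases ts') auto
qed auto

text \<open>The invariant for the leading exponent of an expanded word. After \<open>c\<close> initial letters with base \<open>x\<close>
  there is either nothing to merge with, or a letter \<open>Inr\<close> whose expansion begins with a power of \<open>x\<close>; as a
  power of \<open>(s, b)\<close> comes first only in the expansion of \<open>(Inr s, b)\<close>, its exponent \<open>\<plusminus>M\<close> has the sign
  of the flag of \<open>x\<close>.\<close>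
definition head_ok :: "int \<Rightarrow> 'a gen letter list \<Rightarrow> ('a, 'a letter) syllable list \<Rightarrow> bool" where
  "head_ok M w ts \<longleftrightarrow> (case w of [] \<Rightarrow> ts = [] | (i, b) # _ \<Rightarrow> (\<exists>x e ts'. ts = (None, x, e) # ts' \<and>
     (case i of
       Inl y \<Rightarrow> x = y \<and> (\<exists>c. 1 \<le> c \<and> c \<le> int (length w) \<and>
         (e = sgn_of b * c \<or> e = sgn_of (snd x) * M + sgn_of b * c))
     | Inr s \<Rightarrow> x = (s, b) \<and> e = sgn_of b * M)))"

text \<open>A cancellation could only occur when a new exponent is added to the leading one. A run of \<open>c\<close> letters
  cannot cancel \<open>\<plusminus>M\<close>, as \<open>c \<le> length w < M\<close>. When \<open>Inr s\<close> or its inverse is prepended, the sum is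
  \<open>\<plusminus>M \<plusminus> c\<close> or, if \<open>\<plusminus>M\<close> meets \<open>\<mp>M\<close>, just \<open>\<plusminus>c\<close>; in that case \<open>c\<close> is nonzero since \<open>w\<close> is reduced.\<close>
lemma syllables_alternating_aux:
  assumes "reduced w" "int (length w) < M"
  shows "alternating (syllables M w) \<and> head_ok M w (syllables M w)"
  using assms
proof (induction w)
  case (Cons l w)
  define ts where "ts = syllables M w"
  have IH: "alternating ts" "head_ok M w ts"
    using Cons.IH reduced_tl[OF Cons.prems(1)] Cons.prems(2) by (auto simp: ts_def)
  have M: "M > 0" "int (length w) < M" "int (length w) + 1 < M" using Cons.prems(2) by auto
  obtain i b where l: "l = (i, b)" by (cases l)
  have "alternating (prepend_letter M l ts) \<and> head_ok M (l # w) (prepend_letter M l ts)"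
  proof (cases w)
    case Nil
    then have "ts = []" using IH(2) by (simp add: head_ok_def)
    then show ?thesis
      using M by (cases i) (auto simp: l head_ok_def sgn_of_def)
  next
    case w: (Cons l' w')
    obtain i' b' where l': "l' = (i', b')" by (cases l')
    obtain x e ts' where ts: "ts = (None, x, e) # ts'" and
      head: "case i' of Inl y \<Rightarrow> x = y \<and> (\<exists>c. 1 \<le> c \<and> c \<le> int (length (l' # w')) \<and>
           (e = sgn_of b' * c \<or> e = sgn_of (snd x) * M + sgn_of b' * c))
         | Inr s \<Rightarrow> x = (s, b') \<and> e = sgn_of b' * M"
      using IH(2) unfolding head_ok_def w l' list.case prod.case by blast
    have red: "i = i' \<Longrightarrow> b = b'" using Cons.prems(1) by (auto simp: l w l' formal_inv_def)
    show ?thesis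
    proof (cases i)
      case (Inl y)
      show ?thesis
      proof (cases "x = y")
        case False
        then have "push y (sgn_of b) ts = (None, y, sgn_of b) # ts" by (simp add: ts)
        then show ?thesis using IH(1) False
          by (auto simp: l Inl ts head_ok_def sgn_of_def intro: exI[of _ 1])
      next
        case True
        then have p: "push y (sgn_of b) ts = (None, y, sgn_of b + e) # ts'" by (simp add: ts)
        have c: "\<exists>c. 1 \<le> c \<and> c \<le> int (length (l # w)) \<and>
            (sgn_of b + e = sgn_of b * c \<or> sgn_of b + e = sgn_of (snd y) * M + sgn_of b * c)"
        proof (cases i')
          case i': (Inl y')
          then obtain c where c: "y' = y" "1 \<le> c" "c \<le> int (length w)"
              "e = sgn_of b' * c \<or> e = sgn_of (snd y) * M + sgn_of b' * c"
            using head True w by auto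
          then have "b' = b" using red i' Inl by simp
          with c show ?thesis
            by (intro exI[of _ "c + 1"]) (auto simp: algebra_simps)
        next
          case i': (Inr s)
          then have "e = sgn_of (snd y) * M" using head True by auto
          then show ?thesis by (intro exI[of _ 1]) auto
        qed
        then have "sgn_of b + e \<noteq> 0"
          using M by (auto simp: sgn_of_def split: if_splits)
        then have "alternating ((None, y, sgn_of b + e) # ts')"
          using IH(1) True unfolding ts by (cases ts') auto
        then show ?thesis using c p by (simp add: l Inl head_ok_def)
      qed
    next
      case (Inr s)
      have "alternating (push (s, \<not> b) (sgn_of b * M) ts)"
      proof (rule alternating_push[OF IH(1)])
        show "sgn_of b * M \<noteq> 0" using M by (simp add: sgn_of_def)
      next
        fix d us assume "ts = (None, (s, \<not> b), d) # us"
        then have x: "x = (s, \<not> b)" "d = e" using ts by auto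
        show "sgn_of b * M + d \<noteq> 0"
        proof (cases i')
          case i': (Inl y')
          then obtain c where "1 \<le> c" "c \<le> int (length w)"
              "e = sgn_of b' * c \<or> e = sgn_of (snd x) * M + sgn_of b' * c"
            using head w by auto
          then show ?thesis using x M by (auto simp: sgn_of_def split: if_splits)
        next
          case i': (Inr s')
          then have "s' = s" "b' = (\<not> b)" using head x by auto
          then show ?thesis using red i' Inr by auto
        qed
      qed (simp add: ts)
      moreover obtain e' us where "push (s, \<not> b) (sgn_of b * M) ts = (None, (s, \<not> b), e') # us"
        using push_Cons[of "(s, \<not> b)" "sgn_of b * M" ts] by auto
      ultimately show ?thesis
        using alternating_mark[of "(s, b)" "push (s, \<not> b) (sgn_of b * M) ts"] M
        by (auto simp: l Inr head_ok_def sgn_of_def)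
    qed
  qed
  then show ?case by (simp add: ts_def)
qed (simp add: head_ok_def)

lemma alternating_syllables:
  assumes "reduced w" "int (length w) < M" "w \<noteq> []"
  shows "alternating (syllables M w)" "syllables M w \<noteq> []"
  using syllables_alternating_aux[OF assms(1,2)] assms(3)
  by (auto simp: head_ok_def split: list.splits)

section \<open>Infinite girth from a big powers group\<close>

text \<open>Distinct names may denote the same element of \<open>G\<close>. Choosing one name for each element of the new
  generating set \<open>S\<close> turns a reduced word over \<open>S\<close> into a reduced word over the names, which has the same
  value.\<close>
lemma (in virtual_hom) girth_infinite:
  assumes fg: "finitely_generated G"
  shows "girth G = \<infinity>"
proof -
  obtain S0 where S0: "finite S0" "S0 \<subseteq> carrier G" "generate G S0 = carrier G"
    using fg by (auto simp: finitely_generated_def finite_generating_set_def)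
  have "enat n \<le> girth G" for n
  proof -
    \<comment> \<open>one more than the greatest length of the words to be made nontrivial\<close>
    define M where "M = int n + 1"
    define W where "W = {w \<in> words (gens S0). w \<noteq> [] \<and> length w \<le> n \<and> reduced w}"
    have "finite (gens S0)" using S0(1) by (simp add: gens_def)
    then have "finite (gens S0 \<times> (UNIV :: bool set))" by simp
    from finite_lists_length_le[OF this, of n] have "finite W"
      by (rule rev_finite_subset) (auto simp: W_def words_def lists_eq_set)
    moreover have "syllables M w \<noteq> [] \<and> alternating (syllables M w) \<and>
        syllables_over S0 (S0 \<times> UNIV) (syllables M w)" if "w \<in> W" for w
      using that alternating_syllables[of w M] syllables_over_syllables[of w S0 M]
      by (auto simp: W_def M_def)
    ultimately have "\<exists>g. (\<forall>x\<in>S0 \<times> UNIV. g x \<in> carrier G) \<and>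
        (\<forall>ts\<in>syllables M ` W. syllables_value G g ts \<noteq> \<one>)"
      using S0(1) by (intro ex_independent_family[OF _ _ S0(2)]) auto
    then obtain g where "\<forall>x\<in>S0 \<times> UNIV. g x \<in> carrier G"
        "\<forall>ts\<in>syllables M ` W. syllables_value G g ts \<noteq> \<one>"
      by (elim exE conjE)
    then have g: "\<And>x. x \<in> S0 \<times> UNIV \<Longrightarrow> g x \<in> carrier G"
        "\<And>w. w \<in> W \<Longrightarrow> syllables_value G g (syllables M w) \<noteq> \<one>"
      by auto
    define v where "v = gen_value G M g"
    define S where "S = v ` gens S0"
    have v: "v i \<in> carrier G" if "i \<in> gens S0" for i
      using that g(1) S0(2) by (auto simp: v_def gen_value_def gens_def)
    then have SG: "S \<subseteq> carrier G" by (auto simp: S_def)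
    interpret T: subgroup "generate G S" G using SG by (rule generate_is_subgroup)
    have vT: "v i \<in> generate G S" if "i \<in> gens S0" for i
      using that by (auto simp: S_def intro: generate.incl)
    have "s \<in> generate G S" if s: "s \<in> S0" for s
    proof -
      define a b where "a = v (Inl (s, True)) [^] M" and "b = v (Inl (s, False)) [^] M"
      have ab: "a \<in> generate G S" "b \<in> generate G S"
        unfolding a_def b_def using s
        by (auto intro!: subgroup_int_pow_closed[OF T.subgroup_axioms] vT simp: gens_def)
      have sG: "s \<in> carrier G" using s S0 by blast
      have "v (Inr s) = a \<otimes> (s \<otimes> b)" by (simp add: v_def gen_value_def a_def b_def)
      then have "inv a \<otimes> v (Inr s) \<otimes> inv b = s"
        using T.mem_carrier[OF ab(1)] T.mem_carrier[OF ab(2)] sG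
        by (simp add: m_assoc inv_cancel)
      moreover have "inv a \<otimes> v (Inr s) \<otimes> inv b \<in> generate G S"
        using ab vT[of "Inr s"] s by (auto simp: gens_def)
      ultimately show ?thesis by simp
    qed
    then have "generate G S0 \<subseteq> generate G S"
      by (intro generate_subgroup_incl T.subgroup_axioms) auto
    then have "generate G S = carrier G" using S0(3) T.subset by blast
    moreover have "finite S" using S0(1) by (simp add: S_def gens_def)
    ultimately have S: "finite_generating_set G S" using SG by (simp add: finite_generating_set_def)
    have "n \<le> length w" if w: "w \<in> words S" "w \<noteq> []" "reduced w" "word_value G w = \<one>" for w
    proof (rule ccontr)
      assume "\<not> n \<le> length w"
      define h where "h = inv_into (gens S0) v"
      have h: "inj_on h S" "h ` S \<subseteq> gens S0"
        unfolding h_def S_def by (auto intro: inj_on_inv_into inv_into_into)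
      have "rename h w \<in> words (h ` S)" by (rule rename_words) fact
      then have hw: "rename h w \<in> words (gens S0)" using h(2) by (auto simp: words_def)
      have "reduced (rename h w)" using rename_reduced[OF h(1) w(1)] w(3) by simp
      moreover have "length (rename h w) = length w" by (simp add: rename_def)
      ultimately have "rename h w \<in> W"
        using hw w(2) \<open>\<not> n \<le> length w\<close> by (auto simp: W_def)
      moreover have "rename v (rename h w) = w"
        using w(1) by (induction w) (auto simp: h_def S_def f_inv_into_f)
      moreover have "syllables_value G g (syllables M (rename h w)) = word_value G (rename v (rename h w))"
        unfolding v_def by (rule syllables_value_syllables[OF S0(2) _ hw]) (rule g(1))
      ultimately show False using g(2)[of "rename h w"] w(4) by simp
    qed
    then have "enat n \<le> girth_wrt G S"
      unfolding girth_wrt_def by (intro INF_greatest) (auto simp: cyclically_reduced_def)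
    also have "\<dots> \<le> girth G" unfolding girth_def using S by (intro SUP_upper) simp
    finally show ?thesis .
  qed
  note le = this
  show ?thesis
  proof (cases "girth G")
    case (enat m)
    then show ?thesis using le[of "Suc m"] by simp
  qed
qed

section \<open>The quaternion algebra with squares 2 and 3\<close>

text \<open>Quaternions with \<open>i\<^sup>2 = 2\<close>, \<open>j\<^sup>2 = 3\<close> and \<open>k = i j = - j i\<close>. The coefficients are kept general because
  integral quaternions form the group and real ones serve for the limits. Over the reals this is the
  algebra of two by two matrices, the norm being the determinant and twice the first
  coordinate being the trace.\<close>
datatype 'a quat = Quat (qre: 'a) (qi: 'a) (qj: 'a) (qk: 'a)

instantiation quat :: (comm_ring_1) ring_1
begin
definition "0 = Quat 0 0 0 0"
definition "1 = Quat 1 0 0 0"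
definition "p + q = Quat (qre p + qre q) (qi p + qi q) (qj p + qj q) (qk p + qk q)"
definition "- q = Quat (- qre q) (- qi q) (- qj q) (- qk q)"
definition "p - q = Quat (qre p - qre q) (qi p - qi q) (qj p - qj q) (qk p - qk q)"
definition "p * q = Quat
   (qre p * qre q + 2 * (qi p * qi q) + 3 * (qj p * qj q) - 6 * (qk p * qk q))
   (qre p * qi q + qi p * qre q - 3 * (qj p * qk q) + 3 * (qk p * qj q))
   (qre p * qj q + qj p * qre q + 2 * (qi p * qk q) - 2 * (qk p * qi q))
   (qre p * qk q + qk p * qre q + qi p * qj q - qj p * qi q)"
instance
  by standard (simp_all add: zero_quat_def one_quat_def plus_quat_def minus_quat_def
      uminus_quat_def times_quat_def algebra_simps)
end

lemmas quat_defs = zero_quat_def one_quat_def plus_quat_def minus_quat_def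
      uminus_quat_def times_quat_def

definition qscalar :: "'a::comm_ring_1 \<Rightarrow> 'a quat" where
  "qscalar r = Quat r 0 0 0"

definition qconj :: "'a::comm_ring_1 quat \<Rightarrow> 'a quat" where
  "qconj q = Quat (qre q) (- qi q) (- qj q) (- qk q)"

definition qnorm :: "'a::comm_ring_1 quat \<Rightarrow> 'a" where
  "qnorm q = qre q * qre q - 2 * (qi q * qi q) - 3 * (qj q * qj q) + 6 * (qk q * qk q)"

lemma qscalar_commute: "q * qscalar r = qscalar r * q"
  by (simp add: qscalar_def quat_defs mult.commute)

lemma qscalar_1: "qscalar 1 = 1" and qscalar_0: "qscalar 0 = 0"
  and qscalar_mult: "qscalar (r * s) = qscalar r * qscalar s"
  and qscalar_diff: "qscalar (r - s) = qscalar r - qscalar s"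
  by (simp_all add: qscalar_def quat_defs)

lemma qconj_mult_self: "qconj q * q = qscalar (qnorm q)" "q * qconj q = qscalar (qnorm q)"
  by (simp_all add: qconj_def qnorm_def qscalar_def quat_defs algebra_simps)

lemma qnorm_mult: "qnorm (p * q) = qnorm p * qnorm q"
  by (simp add: qnorm_def times_quat_def) (simp add: algebra_simps)

text \<open>A quaternion plus its conjugate is its trace; take this for \<open>Y V\<close> and multiply by \<open>Y\<close> from the right.\<close>
lemma quat_sandwich: "Y * V * Y = qscalar (2 * qre (Y * V)) * Y - qscalar (qnorm Y) * qconj V"
  by (simp add: qnorm_def qscalar_def qconj_def quat_defs) (simp add: algebra_simps)

lemma qscalar_mult_eq_0: "qscalar r * q = 0 \<longleftrightarrow> r = 0 \<or> q = (0::real quat)"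
  by (cases q) (auto simp: qscalar_def quat_defs)

text \<open>For matrices, this says that \<open>X Y Z \<noteq> 0\<close> if \<open>Y\<close> has rank one, does not map into the kernel of \<open>X\<close> and does not
  vanish on the image of \<open>Z\<close>. If \<open>X Y Z = 0\<close>, then \<open>X (Y Z W Y)\<close> is the trace of \<open>Y Z W\<close> times \<open>X Y\<close>,
  so all these traces vanish, and \<open>Y Z = 0\<close> as the trace form is nondegenerate.\<close>
lemma isotropic_mult_nonzero:
  fixes X Y Z :: "real quat"
  assumes "qnorm Y = 0" "X * Y \<noteq> 0" "Y * Z \<noteq> 0"
  shows "X * Y * Z \<noteq> 0"
proof
  assume *: "X * Y * Z = 0"
  have "qre (Y * Z * W) = 0" for W
  proof -
    have "X * Y * Z * W * Y = X * (Y * (Z * W) * Y)" by (simp add: mult.assoc)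
    also have "\<dots> = qscalar (2 * qre (Y * (Z * W))) * (X * Y)"
      unfolding quat_sandwich using assms(1)
      by (simp add: qscalar_0 qscalar_commute flip: mult.assoc)
    finally have "qscalar (2 * qre (Y * (Z * W))) * (X * Y) = 0" using * by simp
    then show ?thesis using assms(2) by (simp add: qscalar_mult_eq_0 mult.assoc)
  qed
  from this[of "Quat 1 0 0 0"] this[of "Quat 0 1 0 0"] this[of "Quat 0 0 1 0"] this[of "Quat 0 0 0 1"]
  have "Y * Z = 0" by (cases "Y * Z") (simp add: quat_defs)
  with assms(3) show False ..
qed

lemma three_dvd_sum_squares:
  fixes a b :: int assumes "3 dvd a * a + b * b" shows "3 dvd a \<and> 3 dvd b"
proof -
  have m: "(a * a + b * b) mod 3 = ((a mod 3) * (a mod 3) + (b mod 3) * (b mod 3)) mod 3"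
    by (intro mod_add_cong mod_mult_cong) simp_all
  have "a mod 3 = 0 \<or> a mod 3 = 1 \<or> a mod 3 = 2" "b mod 3 = 0 \<or> b mod 3 = 1 \<or> b mod 3 = 2"
    by presburger+
  then show ?thesis using m assms by (elim disjE) (auto simp: dvd_eq_mod_eq_0)
qed

text \<open>Modulo 3 the form is \<open>x\<^sup>2 + y\<^sup>2\<close>, which represents zero only trivially. Once \<open>x\<close> and \<open>y\<close> are divisible by 3,
  the form divided by 3 is congruent to \<open>- (z\<^sup>2 + w\<^sup>2)\<close>.\<close>
lemma norm_form_descent:
  fixes x y z w :: int
  assumes "x * x - 2 * (y * y) - 3 * (z * z) + 6 * (w * w) = 0"
  shows "3 dvd x \<and> 3 dvd y \<and> 3 dvd z \<and> 3 dvd w"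
proof -
  have "x * x + y * y = 3 * (y * y + z * z - 2 * (w * w))" using assms by algebra
  then have xy: "3 dvd x \<and> 3 dvd y" by (intro three_dvd_sum_squares) (metis dvd_triv_left)
  then obtain a b where ab: "x = 3 * a" "y = 3 * b" by (auto elim!: dvdE)
  have "3 * (z * z + w * w) = 3 * (3 * (a * a - 2 * (b * b) + w * w))" using assms ab by algebra
  then have "z * z + w * w = 3 * (a * a - 2 * (b * b) + w * w)" by simp
  then have "3 dvd z \<and> 3 dvd w" by (intro three_dvd_sum_squares) (metis dvd_triv_left)
  with xy show ?thesis by blast
qed

text \<open>So the rational quaternion algebra is a division algebra.\<close>
lemma norm_form_anisotropic:
  fixes x y z w :: int
  assumes "x * x - 2 * (y * y) - 3 * (z * z) + 6 * (w * w) = 0"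
  shows "x = 0 \<and> y = 0 \<and> z = 0 \<and> w = 0"
  using assms
proof (induction "nat (\<bar>x\<bar> + \<bar>y\<bar> + \<bar>z\<bar> + \<bar>w\<bar>)" arbitrary: x y z w rule: less_induct)
  case less
  obtain a b c d where eq: "x = 3 * a" "y = 3 * b" "z = 3 * c" "w = 3 * d"
    using norm_form_descent[OF less.prems] by (auto elim!: dvdE)
  have "9 * (a * a - 2 * (b * b) - 3 * (c * c) + 6 * (d * d)) = 0" using less.prems eq by algebra
  then have n: "a * a - 2 * (b * b) - 3 * (c * c) + 6 * (d * d) = 0" by simp
  show ?case
  proof (rule ccontr)
    assume "\<not> ?case"
    then have "nat (\<bar>a\<bar> + \<bar>b\<bar> + \<bar>c\<bar> + \<bar>d\<bar>) < nat (\<bar>x\<bar> + \<bar>y\<bar> + \<bar>z\<bar> + \<bar>w\<bar>)"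
      using eq by auto
    from less.hyps[OF this n] eq \<open>\<not> ?case\<close> show False by auto
  qed
qed

lemma qnorm_int_eq_0: "qnorm q = 0 \<longleftrightarrow> q = (0 :: int quat)"
  using norm_form_anisotropic[of "qre q" "qi q" "qj q" "qk q"]
  by (cases q) (auto simp: qnorm_def quat_defs)

definition qreal :: "int quat \<Rightarrow> real quat" where
  "qreal q = Quat (of_int (qre q)) (of_int (qi q)) (of_int (qj q)) (of_int (qk q))"

lemma qreal_simps: "qreal 1 = 1" "qreal (p * q) = qreal p * qreal q" "qreal (p - q) = qreal p - qreal q"
  "qnorm (qreal q) = of_int (qnorm q)" "qreal p = qreal q \<longleftrightarrow> p = q" "qreal 0 = 0"
  by (auto simp: qreal_def quat_defs qnorm_def quat.expand)

lemma qreal_power: "qreal (q ^ n) = qreal q ^ n"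
  by (induction n) (auto simp: qreal_simps)

text \<open>The congruence condition modulo 4 excludes the units of trace 0 and \<open>-2\<close>, hence all elliptic elements and
  \<open>-1\<close>.\<close>
definition quat_carrier :: "int quat set" where
  "quat_carrier = {q. qnorm q = 1 \<and> 4 dvd qre q - 1 \<and> 4 dvd qi q \<and> 4 dvd qj q \<and> 4 dvd qk q}"

definition quat_group :: "int quat monoid" where
  "quat_group = \<lparr>carrier = quat_carrier, mult = (*), one = 1\<rparr>"

lemma quat_carrier_mult:
  assumes "p \<in> quat_carrier" "q \<in> quat_carrier"
  shows "p * q \<in> quat_carrier"
proof -
  obtain a b c d where p: "qre p = 4 * a + 1" "qi p = 4 * b" "qj p = 4 * c" "qk p = 4 * d"
    using assms(1) by (auto simp: quat_carrier_def dvd_def algebra_simps)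
  obtain e f g h where q: "qre q = 4 * e + 1" "qi q = 4 * f" "qj q = 4 * g" "qk q = 4 * h"
    using assms(2) by (auto simp: quat_carrier_def dvd_def algebra_simps)
  have "qnorm (p * q) = 1" using assms by (simp add: qnorm_mult quat_carrier_def)
  then show ?thesis unfolding quat_carrier_def mem_Collect_eq
    by (auto simp: times_quat_def p q algebra_simps dvd_add dvd_diff)
qed

text \<open>The only integer congruent to 1 modulo 4 and less than 3 in absolute value is 1. A norm one unit \<open>q\<close> with
  first coordinate 1 satisfies \<open>qnorm (q - 1) = 0\<close>.\<close>
lemma qnorm_1_cong_eq_1:
  assumes "q \<in> quat_carrier" "\<bar>qre q\<bar> < 3"
  shows "q = 1"
proof -
  have "qre q = 1" using assms unfolding quat_carrier_def mem_Collect_eq by presburger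
  with assms have "qnorm (q - 1) = 0" by (simp add: qnorm_def quat_carrier_def quat_defs)
  then show ?thesis by (simp add: qnorm_int_eq_0)
qed

lemma group_quat_group: "group quat_group"
proof (rule groupI)
  fix q assume q: "q \<in> carrier quat_group"
  then have "qconj q \<in> carrier quat_group" "qconj q * q = 1"
    by (auto simp: quat_group_def quat_carrier_def qconj_mult_self qscalar_1)
       (auto simp: qconj_def qnorm_def)
  then show "\<exists>p\<in>carrier quat_group. p \<otimes>\<^bsub>quat_group\<^esub> q = \<one>\<^bsub>quat_group\<^esub>"
    by (auto simp: quat_group_def)
qed (auto simp: quat_group_def mult.assoc quat_carrier_mult, auto simp: quat_carrier_def quat_defs qnorm_def)

lemma quat_commute_iff:
  fixes p q :: "int quat"
  shows "p * q = q * p \<longleftrightarrow>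
    qi p * qj q = qj p * qi q \<and> qi p * qk q = qk p * qi q \<and> qj p * qk q = qk p * qj q"
  by (auto simp: times_quat_def algebra_simps)

text \<open>Two quaternions commute iff their imaginary parts are parallel, and \<open>q \<noteq> 1\<close> has nonzero imaginary part.\<close>
lemma quat_commute_trans:
  assumes "p * q = q * p" "q * r = r * q" "q \<in> quat_carrier" "q \<noteq> 1"
  shows "p * r = r * p"
proof -
  have "qi q \<noteq> 0 \<or> qj q \<noteq> 0 \<or> qk q \<noteq> 0"
  proof (rule ccontr)
    assume 0: "\<not> ?thesis"
    then have "qre q * qre q = 1" using assms(3) by (simp add: quat_carrier_def qnorm_def)
    then have "\<bar>qre q\<bar> < 3" by (auto simp: zmult_eq_1_iff)
    with qnorm_1_cong_eq_1 assms show False by blast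
  qed
  then show ?thesis using assms(1,2) unfolding quat_commute_iff
    by (elim disjE; intro conjI; elim conjE; algebra)
qed

section \<open>Big powers of quaternion units\<close>

definition quat_tendsto :: "(nat \<Rightarrow> real quat) \<Rightarrow> real quat \<Rightarrow> bool" where
  "quat_tendsto f l \<longleftrightarrow> (\<lambda>n. qre (f n)) \<longlonglongrightarrow> qre l \<and> (\<lambda>n. qi (f n)) \<longlonglongrightarrow> qi l \<and>
     (\<lambda>n. qj (f n)) \<longlonglongrightarrow> qj l \<and> (\<lambda>n. qk (f n)) \<longlonglongrightarrow> qk l"

lemma quat_tendsto_const: "quat_tendsto (\<lambda>_. q) q"
  by (simp add: quat_tendsto_def)

lemma quat_tendsto_mult:
  "quat_tendsto f p \<Longrightarrow> quat_tendsto g q \<Longrightarrow> quat_tendsto (\<lambda>n. f n * g n) (p * q)"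
  unfolding quat_tendsto_def times_quat_def quat.sel
  by (intro conjI tendsto_intros; simp)

lemma quat_tendsto_diff:
  "quat_tendsto f p \<Longrightarrow> quat_tendsto g q \<Longrightarrow> quat_tendsto (\<lambda>n. f n - g n) (p - q)"
  unfolding quat_tendsto_def minus_quat_def quat.sel
  by (intro conjI tendsto_intros; simp)

lemma quat_tendsto_qscalar: "f \<longlonglongrightarrow> r \<Longrightarrow> quat_tendsto (\<lambda>n. qscalar (f n)) (qscalar r)"
  by (simp add: quat_tendsto_def qscalar_def)

lemma quat_tendsto_prod_list:
  "(\<And>k. k \<in> set ks \<Longrightarrow> quat_tendsto (\<lambda>n. f n k) (l k)) \<Longrightarrow>
    quat_tendsto (\<lambda>n. prod_list (map (f n) ks)) (prod_list (map l ks))"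
  by (induction ks) (auto intro: quat_tendsto_mult quat_tendsto_const)

lemma quat_tendsto_unique:
  assumes "quat_tendsto f p" "quat_tendsto f q"
  shows "p = q"
  by (rule quat.expand) (use assms in \<open>auto simp: quat_tendsto_def intro: LIMSEQ_unique\<close>)

lemma quat_tendsto_subseq:
  assumes "quat_tendsto f p" "strict_mono r"
  shows "quat_tendsto (\<lambda>n. f (r n)) p"
  using assms LIMSEQ_subseq_LIMSEQ[of _ _ r] by (auto simp: quat_tendsto_def o_def)

text \<open>For \<open>k \<noteq> 1\<close> in \<open>quat_carrier\<close>, the eigenvalue of absolute value greater than 1; the other one is its inverse.\<close>
definition dominant :: "int quat \<Rightarrow> real" where
  "dominant k = (let x = real_of_int (qre k); s = sqrt (x * x - 1) in if x > 0 then x + s else x - s)"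

lemma
  assumes "k \<in> quat_carrier" "k \<noteq> 1"
  shows dominant_gt_1: "\<bar>dominant k\<bar> > 1"
    and dominant_trace: "dominant k + inverse (dominant k) = 2 * of_int (qre k)"
proof -
  define x s where "x = real_of_int (qre k)" and "s = sqrt (x * x - 1)"
  have "3 \<le> \<bar>qre k\<bar>" using qnorm_1_cong_eq_1 assms by (meson not_le)
  then have x: "\<bar>x\<bar> \<ge> 3" unfolding x_def by linarith
  then have "3 * 3 \<le> \<bar>x\<bar> * \<bar>x\<bar>" by (intro mult_mono) auto
  then have "x * x \<ge> 9" by (simp add: abs_mult_self_eq)
  then have s: "s * s = x * x - 1" "s > 0" by (auto simp: s_def)
  have d: "dominant k = (if x > 0 then x + s else x - s)"
    by (simp add: dominant_def x_def s_def Let_def)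
  show "\<bar>dominant k\<bar> > 1" using x s by (auto simp: d)
  then have "dominant k \<noteq> 0" by auto
  moreover have "dominant k * (2 * x - dominant k) = 1"
    using s by (auto simp: d algebra_simps)
  ultimately have "inverse (dominant k) = 2 * x - dominant k"
    by (metis inverse_unique)
  then show "dominant k + inverse (dominant k) = 2 * of_int (qre k)" by (simp add: x_def)
qed

text \<open>Up to a scalar, the projection onto the dominant eigenspace along the other one: the powers of \<open>k\<close>, divided by those of
  the eigenvalue, converge to a multiple of it.\<close>
definition eigen_part :: "int quat \<Rightarrow> real quat" where
  "eigen_part k = qreal k - qscalar (inverse (dominant k))"

definition normalized_power :: "nat \<Rightarrow> int quat \<Rightarrow> real quat" where
  "normalized_power n k = eigen_part k -
     qscalar ((inverse (dominant k) / dominant k) ^ n) * (qreal k - qscalar (dominant k))"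

text \<open>The first two equations are the factorization of the characteristic polynomial of \<open>k\<close>, the roots
  of which are the dominant eigenvalue and its inverse.\<close>
lemma eigen_equations:
  assumes "k \<in> quat_carrier" "k \<noteq> 1"
  shows "qreal k * eigen_part k = qscalar (dominant k) * eigen_part k"
    and "(qreal k - qscalar (dominant k)) * qreal k =
      qscalar (inverse (dominant k)) * (qreal k - qscalar (dominant k))"
    and "qnorm (eigen_part k) = 0"
proof -
  define x l m where "x = real_of_int (qre k)" and "l = dominant k" and "m = inverse l"
  note defs = x_def l_def m_def
  have "l \<noteq> 0" using dominant_gt_1[OF assms] by (auto simp: defs)
  then have lm: "l * m = 1" "2 * x = l + m"
    using dominant_trace[OF assms] by (auto simp: defs)
  define y z w where "y = real_of_int (qi k)" and "z = real_of_int (qj k)" and "w = real_of_int (qk k)"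
  have k: "qreal k = Quat x y z w" by (simp add: qreal_def defs y_def z_def w_def)
  have "qnorm (qreal k) = 1" using assms by (simp add: qreal_simps quat_carrier_def)
  then have n: "x * x - 2 * (y * y) - 3 * (z * z) + 6 * (w * w) = 1"
    by (simp add: k qnorm_def)
  have x: "x = (l + m) / 2" using lm by simp
  have e: "eigen_part k = qreal k - qscalar m" by (simp add: eigen_part_def defs)
  have x0: "2 * y * y + 3 * z * z - 6 * w * w = x * x - 1" using n by (simp add: algebra_simps)
  \<comment> \<open>eliminating \<open>y * y\<close> with norm 1 turns all three claims into identities in the other variables\<close>
  have "2 * (y * y) + 3 * (z * z) - 6 * (w * w) = (l - m) * (l - m) / 4"
    using x0 lm(1) unfolding x by (simp add: field_simps)
  then have yy: "2 * (y * y) = (l - m) * (l - m) / 4 - 3 * (z * z) + 6 * (w * w)" by simp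
  show "qreal k * eigen_part k = qscalar (dominant k) * eigen_part k"
    unfolding e k l_def[symmetric]
    by (simp add: qscalar_def quat_defs yy) (simp add: x field_simps)
  show "(qreal k - qscalar (dominant k)) * qreal k =
      qscalar (inverse (dominant k)) * (qreal k - qscalar (dominant k))"
    unfolding k l_def[symmetric] m_def[symmetric]
    by (simp add: qscalar_def quat_defs yy) (simp add: x field_simps)
  show "qnorm (eigen_part k) = 0"
    unfolding e k by (simp add: qscalar_def quat_defs qnorm_def yy) (simp add: x field_simps)
qed

text \<open>If \<open>(k - \<mu>) Y = 0\<close> for \<open>Y = eigen_part l\<close>, then \<open>k\<close> and \<open>l\<close> both act on \<open>Y\<close> from the left as
  scalars, so \<open>Z = k l - l k\<close> annihilates \<open>Y\<close>. But \<open>Z\<close> is a nonzero integral quaternion and therefore invertible over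
  the reals, which forces \<open>Y = 0\<close>.\<close>
lemma eigen_part_mult_nonzero:
  assumes "k \<in> quat_carrier" "k \<noteq> 1" "l \<in> quat_carrier" "l \<noteq> 1" "k * l \<noteq> l * k"
  shows "eigen_part k * eigen_part l \<noteq> 0"
proof
  define Y where "Y = eigen_part l"
  assume "eigen_part k * eigen_part l = 0"
  then have kY: "qreal k * Y = qscalar (inverse (dominant k)) * Y"
    by (simp add: eigen_part_def[of k] Y_def left_diff_distrib)
  have lY: "qreal l * Y = qscalar (dominant l) * Y"
    unfolding Y_def by (rule eigen_equations) fact+
  have "qreal (k * l) * Y = qreal k * qscalar (dominant l) * Y"
    by (simp add: qreal_simps lY mult.assoc)
  also have "\<dots> = qscalar (dominant l) * (qscalar (inverse (dominant k)) * Y)"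
    unfolding qscalar_commute[of "qreal k"] by (simp add: mult.assoc kY)
  finally have 1: "qreal (k * l) * Y = qscalar (dominant l * inverse (dominant k)) * Y"
    by (simp add: qscalar_mult mult.assoc)
  have "qreal (l * k) * Y = qreal l * qscalar (inverse (dominant k)) * Y"
    by (simp add: qreal_simps kY mult.assoc)
  also have "\<dots> = qscalar (inverse (dominant k)) * (qscalar (dominant l) * Y)"
    unfolding qscalar_commute[of "qreal l"] by (simp add: mult.assoc lY)
  finally have 2: "qreal (l * k) * Y = qscalar (dominant l * inverse (dominant k)) * Y"
    by (simp add: qscalar_mult mult.assoc[symmetric] mult.commute[of "dominant l"])
  define Z where "Z = k * l - l * k"
  have "qreal Z * Y = 0" using 1 2 by (simp add: Z_def qreal_simps(3) left_diff_distrib)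
  then have "qconj (qreal Z) * qreal Z * Y = 0" by (simp add: mult.assoc)
  moreover have "qnorm Z \<noteq> 0" using assms by (simp add: Z_def qnorm_int_eq_0)
  ultimately have "Y = 0" by (simp add: qconj_mult_self qscalar_mult_eq_0 qreal_simps)
  then have "qreal l = qscalar (inverse (dominant l))" by (simp add: Y_def eigen_part_def)
  then have "qreal (k * l) = qreal (l * k)" by (simp add: qreal_simps(2) qscalar_commute[of "qreal k"])
  then have "k * l = l * k" by (simp only: qreal_simps(5))
  with assms show False by simp
qed

lemma eigen_part_nonzero:
  assumes "k \<in> quat_carrier" "k \<noteq> 1"
  shows "eigen_part k \<noteq> 0"
proof
  assume "eigen_part k = 0"
  then have "qnorm (qreal k) = inverse (dominant k) * inverse (dominant k)"
    by (simp add: eigen_part_def qscalar_def qnorm_def)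
  then have "dominant k * dominant k = 1"
    using assms dominant_gt_1[OF assms]
    by (auto simp: qreal_simps quat_carrier_def field_simps split: if_splits)
  with dominant_gt_1[OF assms] show False
    by (metis abs_1 abs_minus square_eq_1_iff less_irrefl)
qed

lemma power_eq_normalized_power:
  assumes "k \<in> quat_carrier" "k \<noteq> 1"
  shows "qscalar (dominant k ^ n) * normalized_power n k =
    qscalar (dominant k - inverse (dominant k)) * qreal k ^ n"
proof -
  define l m where "l = dominant k" and "m = inverse l"
  have l: "l \<noteq> 0" using dominant_gt_1[OF assms] by (auto simp: l_def)
  note eq = eigen_equations[OF assms, folded l_def, folded m_def]
  have eK: "eigen_part k * qreal k = qscalar l * eigen_part k"
    using eq(1) by (simp add: eigen_part_def right_diff_distrib left_diff_distrib qscalar_commute[of "qreal k"])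
  have *: "qscalar (l ^ n) * eigen_part k - qscalar (m ^ n) * (qreal k - qscalar l) =
      qscalar (l - m) * qreal k ^ n"
  proof (induction n)
    case 0
    show ?case by (simp add: eigen_part_def l_def[symmetric] m_def[symmetric] qscalar_1 qscalar_diff)
  next
    case (Suc n)
    have "qscalar (l - m) * qreal k ^ Suc n = (qscalar (l - m) * qreal k ^ n) * qreal k"
      by (simp add: mult.assoc power_commutes)
    also have "\<dots> = qscalar (l ^ n) * (eigen_part k * qreal k) -
        qscalar (m ^ n) * ((qreal k - qscalar l) * qreal k)"
      unfolding Suc[symmetric] left_diff_distrib[of "qscalar (l ^ n) * eigen_part k"]
      by (simp only: mult.assoc)
    also have "\<dots> = qscalar (l ^ n * l) * eigen_part k -
        qscalar (m ^ n * m) * (qreal k - qscalar l)"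
      unfolding eK eq(2) by (simp only: qscalar_mult mult.assoc)
    finally show ?case by (simp add: mult.commute)
  qed
  have "l ^ n * (m / l) ^ n = m ^ n" using l by (simp add: power_divide)
  then have "qscalar (m ^ n) = qscalar (l ^ n) * qscalar ((m / l) ^ n)"
    by (simp flip: qscalar_mult)
  then show ?thesis
    unfolding *[symmetric, unfolded l_def m_def] normalized_power_def
    by (simp only: l_def m_def right_diff_distrib mult.assoc)
qed

lemma normalized_power_tendsto:
  assumes "k \<in> quat_carrier" "k \<noteq> 1"
  shows "quat_tendsto (\<lambda>n. normalized_power n k) (eigen_part k)"
proof -
  have d: "\<bar>dominant k\<bar> > 1" by (rule dominant_gt_1) fact+
  then have "1 * 1 < \<bar>dominant k\<bar> * \<bar>dominant k\<bar>" by (intro mult_strict_mono) auto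
  then have "\<bar>inverse (dominant k) / dominant k\<bar> < 1"
    using d by (auto simp: abs_mult abs_divide field_simps)
  then have "(\<lambda>n. (inverse (dominant k) / dominant k) ^ n) \<longlonglongrightarrow> 0"
    by (intro LIMSEQ_power_zero) simp
  from quat_tendsto_diff[OF quat_tendsto_const quat_tendsto_mult[OF quat_tendsto_qscalar[OF this] quat_tendsto_const]]
  show ?thesis unfolding normalized_power_def by (simp add: qscalar_0)
qed

lemma prod_eigen_part_nonzero:
  assumes "ks \<noteq> []" "\<And>k. k \<in> set ks \<Longrightarrow> k \<in> quat_carrier \<and> k \<noteq> 1"
    "successively (\<lambda>k l. k * l \<noteq> l * k) ks"
  shows "prod_list (map eigen_part ks) \<noteq> 0"
  using assms
proof (induction ks rule: induct_list012)
  case (2 k)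
  then show ?case by (simp add: eigen_part_nonzero)
next
  case (3 k l ks)
  have "prod_list (map eigen_part (l # ks)) \<noteq> 0" using 3 by simp
  moreover have "eigen_part k * eigen_part l \<noteq> 0"
    using 3 by (intro eigen_part_mult_nonzero) auto
  moreover have "qnorm (eigen_part l) = 0" using 3 by (intro eigen_equations) auto
  ultimately show ?case
    using isotropic_mult_nonzero[of "eigen_part l" "eigen_part k" "prod_list (map eigen_part ks)"]
    by (simp add: mult.assoc)
qed simp

lemma prod_qscalar:
  "prod_list (map (\<lambda>k. qscalar (f k) * g k) ks) =
    qscalar (prod_list (map f ks)) * prod_list (map g (ks :: 'b list) :: 'a::comm_ring_1 quat list)"
proof (induction ks)
  case (Cons k ks)
  have "prod_list (map (\<lambda>k. qscalar (f k) * g k) (k # ks)) =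
      qscalar (f k) * (g k * qscalar (prod_list (map f ks))) * prod_list (map g ks)"
    by (simp add: Cons mult.assoc)
  also have "g k * qscalar (prod_list (map f ks)) = qscalar (prod_list (map f ks)) * g k"
    by (rule qscalar_commute)
  finally show ?case by (simp add: qscalar_mult mult.assoc)
qed (simp add: qscalar_1)

text \<open>Suppose the product is 1 for infinitely many exponents. Divide each factor \<open>k\<^sup>n\<close> by the \<open>n\<close>-th power of its
  dominant eigenvalue. Along these exponents the product tends to 0, and also to the
  product of the \<open>eigen_part k\<close> times \<open>c\<close>, which is nonzero.\<close>
lemma quat_big_powers:
  assumes ne: "ks \<noteq> []" and ks: "\<And>k. k \<in> set ks \<Longrightarrow> k \<in> quat_carrier \<and> k \<noteq> 1"
    and succ: "successively (\<lambda>k l. k * l \<noteq> l * k) ks" and c: "c \<in> quat_carrier"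
  shows "eventually (\<lambda>n. prod_list (map (\<lambda>k. k ^ n) ks) * c \<noteq> 1) sequentially"
proof (rule ccontr)
  assume "\<not> ?thesis"
  then have "frequently (\<lambda>n. prod_list (map (\<lambda>k. k ^ n) ks) * c = 1) sequentially"
    by (simp add: frequently_def)
  then have "infinite {n. prod_list (map (\<lambda>k. k ^ n) ks) * c = 1}"
    unfolding cofinite_eq_sequentially[symmetric] frequently_cofinite .
  then obtain r :: "nat \<Rightarrow> nat" where r: "strict_mono r"
      "\<And>n. prod_list (map (\<lambda>k. k ^ r n) ks) * c = 1"
    using infinite_enumerate by blast
  \<comment> \<open>\<open>power_eq_normalized_power\<close> solved for the normalized power\<close>
  define a where "a n k = (dominant k - inverse (dominant k)) / dominant k ^ n" for n k
  have np: "normalized_power n k = qscalar (a n k) * qreal k ^ n" if "k \<in> set ks" for n k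
  proof -
    have d: "dominant k \<noteq> 0" using dominant_gt_1 ks[OF that] by fastforce
    have "normalized_power n k = qscalar (inverse (dominant k ^ n) * dominant k ^ n) * normalized_power n k"
      using d by (simp add: qscalar_1)
    also have "\<dots> = qscalar (inverse (dominant k ^ n)) * (qscalar (dominant k - inverse (dominant k)) * qreal k ^ n)"
      using power_eq_normalized_power[of k n] ks[OF that] by (simp add: qscalar_mult mult.assoc)
    finally show ?thesis
      by (simp add: a_def divide_inverse qscalar_mult mult.commute flip: mult.assoc)
  qed
  have pl: "prod_list (map (normalized_power n) ks) =
      qscalar (prod_list (map (a n) ks)) * prod_list (map (\<lambda>k. qreal k ^ n) ks)" for n
    unfolding prod_qscalar[symmetric] using np by (intro arg_cong[of _ _ prod_list] map_cong) auto
  have qr: "qreal (prod_list (map (\<lambda>k. k ^ n) ks')) = prod_list (map (\<lambda>k. qreal k ^ n) ks')" for n ks'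
    by (induction ks') (simp_all add: qreal_simps qreal_power)
  have "prod_list (map (normalized_power (r n)) ks) * qreal c = qscalar (prod_list (map (a (r n)) ks))" for n
    using arg_cong[OF r(2)[of n], of qreal]
    by (simp add: pl qreal_simps(1,2) qr mult.assoc)
  moreover have "(\<lambda>n. prod_list (map (a n) ks)) \<longlonglongrightarrow> 0"
  proof -
    have az: "(\<lambda>n. a n k) \<longlonglongrightarrow> 0" if "k \<in> set ks" for k
    proof -
      have "norm (inverse (dominant k)) < 1"
        using dominant_gt_1[of k] ks[OF that] by (simp add: inverse_less_1_iff abs_inverse)
      from tendsto_mult_right_zero[OF LIMSEQ_power_zero[OF this]]
      show ?thesis unfolding a_def by (simp add: divide_inverse power_inverse)
    qed
    have "(\<lambda>n. prod_list (map (a n) ks)) \<longlonglongrightarrow> prod_list (map (\<lambda>_. 0) ks)"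
      using az
    proof (induction ks)
      case (Cons k ks)
      then show ?case using tendsto_mult[OF Cons.prems(1)[of k] Cons.IH] by simp
    qed simp
    moreover have "prod_list (map (\<lambda>_. 0::real) ks) = 0" using ne by (cases ks) auto
    ultimately show ?thesis by simp
  qed
  from quat_tendsto_subseq[OF quat_tendsto_qscalar[OF this] r(1)]
  have "quat_tendsto (\<lambda>n. qscalar (prod_list (map (a (r n)) ks))) 0" by (simp add: qscalar_0)
  moreover have "quat_tendsto (\<lambda>n. prod_list (map (normalized_power (r n)) ks) * qreal c)
      (prod_list (map eigen_part ks) * qreal c)"
    using ks by (intro quat_tendsto_mult quat_tendsto_const quat_tendsto_prod_list
        quat_tendsto_subseq[OF _ r(1)] normalized_power_tendsto) auto
  ultimately have "prod_list (map eigen_part ks) * qreal c = 0"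
    using quat_tendsto_unique by simp
  then have "prod_list (map eigen_part ks) * (qreal c * qconj (qreal c)) = 0"
    by (simp flip: mult.assoc)
  moreover have "qreal c * qconj (qreal c) = 1"
    using c by (simp add: qconj_mult_self qreal_simps quat_carrier_def qscalar_1)
  ultimately show False using prod_eigen_part_nonzero[OF ne ks succ] by simp
qed

lemma quat_nat_pow: "k [^]\<^bsub>quat_group\<^esub> (n::nat) = k ^ n"
  by (induction n) (simp_all add: quat_group_def nat_pow_def power_commutes)

lemma commutation_transitive_quat_group: "commutation_transitive quat_group"
  unfolding commutation_transitive_def
  by (auto simp: quat_group_def intro: quat_commute_trans)

lemma big_powers_quat_group: "big_powers quat_group"
  unfolding big_powers_def
proof (intro allI impI)
  fix ks :: "int quat list" and c
  assume *: "ks \<noteq> []" "set ks \<subseteq> carrier quat_group - {\<one>\<^bsub>quat_group\<^esub>}" "c \<in> carrier quat_group"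
    "successively (\<lambda>k l. k \<otimes>\<^bsub>quat_group\<^esub> l \<noteq> l \<otimes>\<^bsub>quat_group\<^esub> k) ks"
  have "foldr (\<lambda>k g. k [^]\<^bsub>quat_group\<^esub> n \<otimes>\<^bsub>quat_group\<^esub> g) ks' c = prod_list (map (\<lambda>k. k ^ n) ks') * c"
    for n :: nat and ks'
    by (induction ks') (simp_all add: quat_nat_pow, simp_all add: quat_group_def mult.assoc)
  moreover have "eventually (\<lambda>n. prod_list (map (\<lambda>k. k ^ n) ks) * c \<noteq> 1) sequentially"
    using * by (intro quat_big_powers) (auto simp: quat_group_def)
  ultimately show "eventually (\<lambda>n::nat. foldr (\<lambda>k g. k [^]\<^bsub>quat_group\<^esub> n \<otimes>\<^bsub>quat_group\<^esub> g) ks c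
      \<noteq> \<one>\<^bsub>quat_group\<^esub>) sequentially"
    by (simp add: quat_group_def)
qed

section \<open>Homomorphisms from free groups\<close>

text \<open>The homomorphism from the free group that extends the map \<open>v\<close> of the basis.\<close>
definition eval_hom :: "('c, 'd) monoid_scheme \<Rightarrow> ('x \<Rightarrow> 'c) \<Rightarrow> 'x letter list \<Rightarrow> 'c" where
  "eval_hom L v w = word_value L (rename v w)"

lemma eval_hom_simps [simp]:
  "eval_hom L v [] = \<one>\<^bsub>L\<^esub>"
  "eval_hom L v (l # w) = letter_value L (v (fst l), snd l) \<otimes>\<^bsub>L\<^esub> eval_hom L v w"
  by (simp_all add: eval_hom_def word_value_def)

lemma free_group_hom:
  assumes "group L" and v: "\<And>x. x \<in> X \<Longrightarrow> v x \<in> carrier L"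
  shows "eval_hom L v \<in> hom (free_group X) L"
proof -
  interpret L: group L by fact
  have l: "letter_value L (v (fst l), snd l) \<in> carrier L" if "fst l \<in> X" for l
    using v[OF that] by (simp add: letter_value_def)
  have closed: "eval_hom L v w \<in> carrier L" if "w \<in> words X" for w
    using that by (induction w) (auto simp: l)
  have cons: "eval_hom L v (cons_reduce l w) = letter_value L (v (fst l), snd l) \<otimes>\<^bsub>L\<^esub> eval_hom L v w"
    if lw: "fst l \<in> X" "w \<in> words X" for l w
  proof (cases "(l, w)" rule: cons_reduce.cases)
    case (2 _ m w')
    have "eval_hom L v w' \<in> carrier L" "v (fst l) \<in> carrier L" using lw 2 v closed by auto
    then have "letter_value L (v (fst l), snd l) \<otimes>\<^bsub>L\<^esub>
        (letter_value L (v (fst l), \<not> snd l) \<otimes>\<^bsub>L\<^esub> eval_hom L v w') = eval_hom L v w'"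
      by (auto simp: letter_value_def simp flip: L.m_assoc)
    then show ?thesis using 2 by (auto simp: formal_inv_def)
  qed simp
  have mult: "eval_hom L v (foldr cons_reduce u w) = eval_hom L v u \<otimes>\<^bsub>L\<^esub> eval_hom L v w"
    if "u \<in> words X" "w \<in> words X" for u w
    using that by (induction u) (simp_all add: cons foldr_words closed l L.m_assoc)
  show ?thesis by (rule homI) (auto simp: free_group_def closed mult)
qed

text \<open>Over a basis with at most one element, two letters are equal or inverse, so prepending one
  with reduction commutes with prepending the other.\<close>
lemma nonabelian_free_group_basis:
  assumes "\<not> comm_group (free_group X)"
  shows "\<exists>x\<in>X. \<exists>y\<in>X. x \<noteq> y"
proof (rule ccontr)
  assume "\<not> ?thesis"
  then have same: "x = y" if "x \<in> X" "y \<in> X" for x y using that by blast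
  have swap: "cons_reduce l (cons_reduce m w) = cons_reduce m (cons_reduce l w)"
    if "fst l \<in> X" "fst m \<in> X" "reduced w" for l m and w :: "'a letter list"
  proof (cases "l = m")
    case False
    then have "m = formal_inv l" using same[OF that(1,2)] by (auto simp: formal_inv_def prod_eq_iff)
    then show ?thesis
      using cons_reduce_formal_inv[OF that(3), of l] cons_reduce_formal_inv[OF that(3), of m] by simp
  qed simp
  have move: "foldr cons_reduce u (cons_reduce l w) = cons_reduce l (foldr cons_reduce u w)"
    if "u \<in> words X" "fst l \<in> X" "reduced w" for u l w
    using that by (induction u) (auto simp: swap foldr_reduced)
  have comm: "foldr cons_reduce u (foldr cons_reduce v w) = foldr cons_reduce v (foldr cons_reduce u w)"
    if "u \<in> words X" "v \<in> words X" "reduced w" for u v w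
    using that by (induction v) (auto simp: move foldr_reduced)
  have "u \<otimes>\<^bsub>free_group X\<^esub> v = v \<otimes>\<^bsub>free_group X\<^esub> u"
    if "u \<in> carrier (free_group X)" "v \<in> carrier (free_group X)" for u v
    using comm[of u v "[]"] that by (simp add: free_group_def foldr_Nil)
  then have "comm_group (free_group X)"
    by (intro group.group_comm_groupI group_free_group)
  with assms show False ..
qed

theorem corollary5p4:
  fixes \<Gamma> :: "('a, 'b) monoid_scheme"
  assumes "group \<Gamma>" and "finitely_generated \<Gamma>" and "large \<Gamma>"
  shows "girth \<Gamma> = \<infinity>"
proof -
  interpret G: group \<Gamma> by fact
  obtain H and X :: "'a set" and f where H: "subgroup H \<Gamma>" "finite (rcosets\<^bsub>\<Gamma>\<^esub> H)"
    and f: "f \<in> epi (\<Gamma>\<lparr>carrier := H\<rparr>) (free_group X)" and nc: "\<not> comm_group (free_group X)"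
    using assms(3) by (auto simp: large_def)
  obtain x y where xy: "x \<in> X" "y \<in> X" "x \<noteq> y"
    using nonabelian_free_group_basis[OF nc] by blast
  \<comment> \<open>\<open>A = (3 + 2 i)\<^sup>2\<close> and \<open>B = (2 + j)\<^sup>4\<close>, powers of norm one units that satisfy the congruence modulo 4\<close>
  define A B :: "int quat" where "A = Quat 17 12 0 0" and "B = Quat 97 0 56 0"
  have AB: "A \<in> carrier quat_group" "B \<in> carrier quat_group" "A * B \<noteq> B * A"
    by (auto simp: A_def B_def quat_group_def quat_carrier_def qnorm_def times_quat_def)
  define v where "v z = (if z = x then A else if z = y then B else \<one>\<^bsub>quat_group\<^esub>)" for z
  define \<phi> where "\<phi> = eval_hom quat_group v \<circ> f"
  have v: "v z \<in> carrier quat_group" for z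
    using AB group.is_monoid[OF group_quat_group] by (simp add: v_def monoid.one_closed)
  have fH: "f \<in> hom (\<Gamma>\<lparr>carrier := H\<rparr>) (free_group X)" "f ` H = carrier (free_group X)"
    using f by (auto simp: epi_def)
  have "\<phi> \<in> hom (\<Gamma>\<lparr>carrier := H\<rparr>) quat_group"
    unfolding \<phi>_def using fH(1) free_group_hom[OF group_quat_group v] by (rule hom_compose)
  moreover have "\<exists>h\<in>H. \<phi> h = v z" if "z \<in> X" for z
  proof -
    have "[(z, True)] \<in> f ` H" using that by (simp add: fH(2) free_group_def)
    then obtain h where h: "h \<in> H" "f h = [(z, True)]" by auto
    then have "\<phi> h = v z"
      using v[of z] monoid.r_one[OF group.is_monoid[OF group_quat_group]]
      by (simp add: \<phi>_def letter_value_def)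
    with h show ?thesis by blast
  qed
  then have "\<exists>a\<in>H. \<exists>b\<in>H. \<phi> a \<otimes>\<^bsub>quat_group\<^esub> \<phi> b \<noteq> \<phi> b \<otimes>\<^bsub>quat_group\<^esub> \<phi> a"
    using xy AB(3) by (metis (no_types) v_def quat_group_def monoid.simps(1))
  ultimately interpret virtual_hom \<Gamma> quat_group H \<phi>
    using H commutation_transitive_quat_group big_powers_quat_group
    by (intro virtual_hom.intro virtual_hom_axioms.intro G.group_axioms group_quat_group)
  show ?thesis by (rule girth_infinite) fact
qed

end
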